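(* Let $\alpha_n(0)\in(-1,1)$ for all $n\ge0$, let $\mu$ be the (nontrivial, conjugation-symmetric) probability measure on $\partial\mathbb{D}$ with $\alpha_n(\mu)=\alpha_n(0)$, and let $\alpha_n(t)$ solve the Schur flow $\alpha_n'=(1-|\alpha_n|^2)(\alpha_{n+1}-\alpha_{n-1})$, $\alpha_{-1}\equiv-1$. Let $\Theta=\Theta(\mu)$ and let $S=\mathrm{supp}\,\mu\cap\{e^{i\eta}:|\eta|<\Theta\}$. All limits are as $t\to\infty$. (i) If $1\in\sigma_{\mathrm{ess}}(\mu)$, then $\alpha_n(t)\to(-1)^n$ for all $n$. (ii) If $\Theta>0$, $1\notin\mathrm{supp}\,\mu$, and $S$ has $2m$ points ($m\ge0$), written $e^{\pm i\theta_1},\dots,e^{\pm i\theta_m}$ with $0<\theta_1<\cdots<\theta_m<\Theta$, put $N=m+1$, $x_j=\cos\theta_j$ ($1\le j\le m$), $x_N=\cos\Theta$. Then $\alpha_{2n+1}(t)\to-1$ for $n\ge0$, $\alpha_{2n}(t)\to x_{n+1}$ for $0\le n<N$, and $\alpha_{2n}(t)\to x_N$ for $n\ge N-1$. (iii) If $\Theta>0$, $1\notin\mathrm{supp}\,\mu$, and $S$ is infinite, written $e^{\pm i\theta_j}$, $j\ge1$, with $0<\theta_1<\theta_2<\cdots$, put $x_j=\cos\theta_j$. Then $\alpha_{2n+1}(t)\to-1$ and $\alpha_{2n}(t)\to x_{n+1}$ for all $n\ge0$, and $x_j\to\cos\Theta$ as $j\to\infty$. (iv) If $\Theta>0$, $1\in\mathrm{supp}\,\mu$,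 and $S$ has $2m+1$ points, written $1,e^{\pm i\theta_2},\dots,e^{\pm i\theta_{m+1}}$ with $0<\theta_2<\cdots<\theta_{m+1}<\Theta$, put $N=m+1$, $x_j=\cos\theta_{j+1}$ ($1\le j\le m$), $x_N=\cos\Theta$. Then $\alpha_{2n}(t)\to1$ for $n\ge0$, $\alpha_{2n-1}(t)\to-x_n$ for $1\le n<N$, and $\alpha_{2n-1}(t)\to-x_N$ for $n\ge N$. (v) If $\Theta>0$, $1\in\mathrm{supp}\,\mu$, and $S$ is infinite, written $1$ and $e^{\pm i\theta_j}$, $j\ge2$, with $0<\theta_2<\theta_3<\cdots$, put $x_j=\cos\theta_{j+1}$. Then $\alpha_{2n}(t)\to1$ for $n\ge0$, $\alpha_{2n-1}(t)\to-x_n$ for all $n\ge1$, and $x_j\to\cos\Theta$ as $j\to\infty$.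
   Context: Verblunsky coefficients: for a probability measure $\nu$ on $\partial\mathbb{D}$ with monic orthogonal polynomials $\Phi_n(z;\nu)$, $\alpha_n(\nu)=-\overline{\Phi_{n+1}(0;\nu)}$; real sequences in $(-1,1)^\infty$ correspond bijectively to nontrivial probability measures invariant under $z\mapsto\bar z$. $\sigma_{\mathrm{ess}}(\mu)$ is the set of non-isolated points of $\mathrm{supp}\,\mu$, and $\Theta(\mu)=\min\{|\theta|:\theta\in(-\pi,\pi],\ e^{i\theta}\in\sigma_{\mathrm{ess}}(\mu)\}$. The Schur flow has a unique global solution for these initial data. *)

theory Defs
  imports "HOL-Probability.Probability" "HOL-Computational_Algebra.Polynomial"
begin

text \<open>Probability measures on the unit circle are represented as measures on the
Borel sets of the complex plane that are concentrated on the unit circle.\<close>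

definition msupp :: "complex measure \<Rightarrow> complex set" where
  "msupp \<mu> = {z. \<forall>e>0. emeasure \<mu> (ball z e) > 0}"

definition ess_supp :: "complex measure \<Rightarrow> complex set" where
  "ess_supp \<mu> = {z \<in> msupp \<mu>. z islimpt msupp \<mu>}"

definition Theta :: "complex measure \<Rightarrow> real" where
  "Theta \<mu> = Inf {\<bar>\<theta>\<bar> | \<theta>. -pi < \<theta> \<and> \<theta> \<le> pi \<and> cis \<theta> \<in> ess_supp \<mu>}"

definition Sset :: "complex measure \<Rightarrow> complex set" where
  "Sset \<mu> = msupp \<mu> \<inter> {cis \<eta> | \<eta>. \<bar>\<eta>\<bar> < Theta \<mu>}"

definition monic_OP :: "complex measure \<Rightarrow> nat \<Rightarrow> complex poly" where
  "monic_OP \<mu> n = (THE p. degree p = n \<and> lead_coeff p = 1 \<and>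
      (\<forall>k<n. integral\<^sup>L \<mu> (\<lambda>z. poly p z * cnj (z ^ k)) = 0))"

definition verblunsky :: "complex measure \<Rightarrow> nat \<Rightarrow> complex" where
  "verblunsky \<mu> n = - cnj (poly (monic_OP \<mu> (Suc n)) 0)"

definition schur_flow :: "(nat \<Rightarrow> real \<Rightarrow> real) \<Rightarrow> bool" where
  "schur_flow \<alpha> \<longleftrightarrow>
     (\<forall>n t. \<bar>\<alpha> n t\<bar> < 1) \<and>
     (\<forall>n t. ((\<alpha> n) has_real_derivative
        ((1 - (\<alpha> n t)\<^sup>2) * (\<alpha> (Suc n) t - (if n = 0 then -1 else \<alpha> (n - 1) t)))) (at t))"

end

(* Put e 0 = -1 and e (n + 1) = \<alpha> n. Along the flow the derivative of - (\<Sum>j<n. e j * e (j + 1)) telescopes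
   to (1 - (e n)^2) (1 - e (n - 1) * e (n + 1)) \<ge> 0, so each product e n * e (n + 1) converges.

   The \<alpha> n t are the Verblunsky coefficients of exp (2 t Re z) d\<mu>: these satisfy the same flow, whose
   bounded solution is unique. Let h n t be the squared norm of the n-th monic orthogonal polynomial
   for this weight. Then (ln h n)' = - 2 e n * e (n + 1), so the limit of - e n * e (n + 1) is half the exponential
   growth rate of h n. As h n is the minimum of the squared norm over monic polynomials of degree n,
   this limit is the (n + 1)-st largest real part of the points of the support: from above,
   let the polynomial vanish at the n top points; from below, n roots cannot be close to n + 1 distinct points.

   In each case these numbers come in equal pairs, and from the limits of the products the limits of
   the e n follow one after the other. Only when a factor tends to 0 does this need more: then
   Barbalat's lemma applied to the flow equation gives e (n + 1) - e (n - 1) \<longrightarrow> 0. *)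

theory Submission
  imports Defs "HOL-Computational_Algebra.Fundamental_Theorem_Algebra"
begin

section \<open>Analytic and algebraic preliminaries\<close>

text \<open>Existence and value of a limit are separate matters. The bounds on \<open>h n\<close>
  fix \<open>ln (h n)\<close> only up to an additive constant, which does not force its derivative
  to converge; monotonicity supplies the convergence, and then the linear bounds leave one possible
  value. The lower bound needs a constant independent of t although the roots of the minimizing
  polynomial move with t: pigeonhole over finitely many separated balls provides it. The weight
  carries the factor 2 because 2 Re z = z + cnj z: differentiating in t then shifts one of the two
  arguments of the inner product, and this reproduces the flow without a change of time scale. The
  pairs are the points e^(i theta) and e^(-i theta), which share their real part; a point of the
  essential support has infinitely many support points near it, so once the isolated pairs are used
  up cos Theta repeats forever. The point 1 is its own conjugate: when isolated in the support it is
  a single entry at the top of the list, so the pairing starts one index later and even and odd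
  coefficients exchange roles.\<close>

lemma exp_second_order:
  fixes x s :: real
  assumes "\<bar>x\<bar> \<le> 2" "\<bar>s\<bar> \<le> 1"
  shows "\<bar>exp (s * x) - 1 - s * x\<bar> \<le> 4 * exp 2 * s\<^sup>2"
proof -
  \<comment> \<open>Lagrange remainder of order two. The range |x| \<le> 2 is that of 2 Re z on the
    unit circle.\<close>
  obtain u where u: "\<bar>u\<bar> \<le> \<bar>s * x\<bar>"
    and e: "exp (s * x) = (\<Sum>m<2. (s * x) ^ m / fact m) + exp u / fact 2 * (s * x)\<^sup>2"
    using Maclaurin_exp_le[of "s * x" 2] by blast
  have sx: "\<bar>s * x\<bar> \<le> 1 * 2" unfolding abs_mult using assms by (intro mult_mono) auto
  have "\<bar>exp (s * x) - 1 - s * x\<bar> = exp u / 2 * (s * x)\<^sup>2"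
    using e by (simp add: eval_nat_numeral)
  also have "\<dots> \<le> exp 2 * (4 * s\<^sup>2)"
  proof (intro mult_mono)
    show "exp u / 2 \<le> exp 2" using u sx exp_le_cancel_iff[of u 2] exp_gt_zero[of 2] by linarith
    have "x\<^sup>2 \<le> 4" using assms(1) abs_le_square_iff[of x 2] by simp
    then show "(s * x)\<^sup>2 \<le> 4 * s\<^sup>2" using mult_left_mono[of "x\<^sup>2" 4 "s\<^sup>2"] by (simp add: power_mult_distrib mult.commute)
  qed auto
  finally show ?thesis by simp
qed

lemma poly_eq_sum_smult_monom:
  fixes q :: "'a::comm_semiring_1 poly"
  assumes "degree q \<le> n"
  shows "q = (\<Sum>k\<le>n. smult (coeff q k) (monom 1 k))"
  unfolding smult_monom mult.right_neutral by (rule poly_as_sum_of_monoms'[OF assms, symmetric])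

lemma pCons_0_eq_sum_smult_monom:
  fixes q :: "'a::comm_semiring_1 poly"
  assumes "degree q \<le> n"
  shows "pCons 0 q = (\<Sum>k\<le>n. smult (coeff q k) (monom 1 (Suc k)))"
proof -
  have "pCons 0 q = [:0, 1:] * q" by simp
  also have "\<dots> = [:0, 1:] * (\<Sum>k\<le>n. smult (coeff q k) (monom 1 k))"
    by (subst poly_eq_sum_smult_monom[OF assms]) (rule refl)
  finally show ?thesis by (simp add: sum_distrib_left monom_Suc)
qed

lemma differentiable_cnj:
  fixes f :: "real \<Rightarrow> complex"
  assumes "f differentiable (at t)"
  shows "(\<lambda>s. cnj (f s)) differentiable (at t)"
  using assms unfolding differentiable_def by (blast intro: has_derivative_cnj)

text \<open>Collects the derivatives of the coefficients into one polynomial, so that the derivative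
  of a moving polynomial can itself be an argument of the inner product.\<close>

lemma differentiable_coeffs_poly:
  assumes "\<And>k. (\<lambda>s. coeff (P s) k) differentiable (at t)" "\<And>s. degree (P s) \<le> n"
  obtains P' where "degree P' \<le> n"
    "\<And>k. ((\<lambda>s. coeff (P s) k) has_vector_derivative coeff P' k) (at t)"
proof
  define P' where "P' = (\<Sum>k\<le>n. monom (vector_derivative (\<lambda>s. coeff (P s) k) (at t)) k)"
  show "degree P' \<le> n" unfolding P'_def
    by (intro degree_sum_le) (auto intro: order.trans[OF degree_monom_le])
  show "((\<lambda>s. coeff (P s) k) has_vector_derivative coeff P' k) (at t)" for k
  proof (cases "k \<le> n")
    case True
    then have "coeff P' k = vector_derivative (\<lambda>s. coeff (P s) k) (at t)"
      by (simp add: P'_def coeff_sum)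
    then show ?thesis using assms(1) by (metis vector_derivative_works)
  next
    case False
    then have "(\<lambda>s. coeff (P s) k) = (\<lambda>_. 0)"
      using assms(2) by (intro ext coeff_eq_0) (metis le_less_trans not_le)
    moreover have "coeff P' k = 0"
      using False \<open>degree P' \<le> n\<close> by (intro coeff_eq_0) linarith
    ultimately show ?thesis by simp
  qed
qed

lemma norm_poly_prod_roots_ge:
  assumes "\<And>a. a \<in># A \<Longrightarrow> r \<le> norm (z - a)" "r \<ge> 0"
  shows "r ^ size A \<le> norm (poly (\<Prod>a\<in>#A. [:-a, 1:]) (z :: complex))"
  using assms(1)
proof (induction A)
  case (add a A)
  have "r ^ size (add_mset a A) \<le> norm (z - a) * norm (poly (\<Prod>a\<in>#A. [:-a, 1:]) z)"
    using add assms(2) by (simp add: mult_mono)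
  moreover have "poly (\<Prod>a\<in>#add_mset a A. [:-a, 1:]) z = (z - a) * poly (\<Prod>a\<in>#A. [:-a, 1:]) z"
    by (simp add: algebra_simps)
  ultimately show ?case by (simp only: norm_mult)
qed simp

text \<open>Pigeonhole: a root within 2r of two points of \<open>W\<close> would put them at
  distance less than 4r. So if every point had a root that close, distinct points would have
  distinct roots, and there are too few of them.\<close>

lemma exists_point_far_from_roots:
  fixes W :: "'a::metric_space set"
  assumes "size A < card W" "\<And>w w'. w \<in> W \<Longrightarrow> w' \<in> W \<Longrightarrow> w \<noteq> w' \<Longrightarrow> 4 * r < dist w w'"
  obtains w where "w \<in> W" "\<And>a. a \<in># A \<Longrightarrow> 2 * r \<le> dist w a"
proof -
  have "\<exists>w\<in>W. \<forall>a\<in>#A. 2 * r \<le> dist w a"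
  proof (rule ccontr)
    assume "\<not> (\<exists>w\<in>W. \<forall>a\<in>#A. 2 * r \<le> dist w a)"
    then have "\<forall>w\<in>W. \<exists>a. a \<in># A \<and> dist w a < 2 * r" by (auto simp: not_le)
    then obtain f where f: "\<And>w. w \<in> W \<Longrightarrow> f w \<in># A" "\<And>w. w \<in> W \<Longrightarrow> dist w (f w) < 2 * r"
      by metis
    have "inj_on f W"
    proof (rule inj_onI, rule ccontr)
      fix w w' assume w: "w \<in> W" "w' \<in> W" "f w = f w'" "w \<noteq> w'"
      then show False
        using f(2)[of w] f(2)[of w'] assms(2)[of w w'] dist_triangle2[of w w' "f w"] by simp
    qed
    then have "card W \<le> card (set_mset A)" using f(1) by (intro card_inj_on_le) auto
    also have "\<dots> \<le> size A" using size_mset_mono[OF mset_set_set_mset_msubset[of A]] by simp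
    finally show False using assms(1) by simp
  qed
  then show thesis using that by blast
qed

text \<open>One Picard step: the majorant has the assumed bound as its derivative, and the mean
  value inequality integrates it.\<close>

lemma vector_derivative_power_bound:
  fixes f :: "real \<Rightarrow> 'a::real_normed_vector"
  assumes d: "\<And>t. (f has_vector_derivative f' t) (at t)"
    and b: "\<And>t. t \<ge> 0 \<Longrightarrow> norm (f' t) \<le> K * (B * t ^ j / fact j)"
    and "f 0 = 0" "t \<ge> 0"
  shows "norm (f t) \<le> K * B * t ^ Suc j / fact (Suc j)"
proof (cases "t = 0")
  case False
  have "norm (f t - f 0) \<le> K * B * t ^ Suc j / fact (Suc j) - K * B * 0 ^ Suc j / fact (Suc j)"
  proof (rule differentiable_bound_general[of 0 t])
    show "0 < t" using False \<open>t \<ge> 0\<close> by simp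
    show "continuous_on {0..t} f"
      by (meson continuous_at_imp_continuous_on d has_vector_derivative_continuous)
    show "continuous_on {0..t} (\<lambda>s. K * B * s ^ Suc j / fact (Suc j))"
      by (intro continuous_intros) auto
    fix s assume s: "0 < s" "s < t"
    show "(f has_vector_derivative f' s) (at s)" by (rule d)
    show "((\<lambda>s. K * B * s ^ Suc j / fact (Suc j)) has_vector_derivative K * (B * s ^ j / fact j)) (at s)"
    proof -
      have "real (Suc j) / fact (Suc j) = 1 / fact j" by (simp add: fact_Suc del: of_nat_Suc)
      then have "K * B / fact (Suc j) * (real (Suc j) * s ^ j) = K * (B * s ^ j / fact j)"
        by (metis (no_types, opaque_lifting) mult.assoc mult.commute mult_1 times_divide_eq_left times_divide_eq_right)
      with DERIV_cmult[OF DERIV_pow[of "Suc j" s UNIV], of "K * B / fact (Suc j)"] show ?thesis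
        unfolding has_real_derivative_iff_has_vector_derivative[symmetric] by simp
    qed
    show "norm (f' s) \<le> K * (B * s ^ j / fact j)" using b s by simp
  qed
  then show ?thesis using assms by simp
qed (use assms in simp)

lemma less_of_less_Suc_on_interval:
  fixes f :: "nat \<Rightarrow> 'a::order"
  assumes "\<And>j. a \<le> j \<Longrightarrow> j < b \<Longrightarrow> f j < f (Suc j)" "a \<le> i" "i < k" "k \<le> b"
  shows "f i < f k"
  using assms(3,4)
proof (induction k)
  case (Suc k)
  have "f k < f (Suc k)" using Suc.prems assms(2) by (intro assms(1)) auto
  moreover have "i = k \<or> f i < f k" using Suc by (auto simp: less_Suc_eq)
  ultimately show ?case by (auto intro: less_trans)
qed simp

text \<open>The cosine is injective on (0, pi), and the sign of the imaginary part separates the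
  upper points, the lower points and \<open>C\<close>, so nothing coincides.\<close>

lemma card_conjugate_pairs:
  assumes "\<And>i. i \<in> I \<Longrightarrow> 0 < \<phi> i \<and> \<phi> i < pi" "inj_on \<phi> I" "finite I" "C \<subseteq> {1}"
  shows "card (C \<union> (\<Union>i\<in>I. {cis (\<phi> i), cis (- \<phi> i)})) = card C + 2 * card I"
proof -
  let ?U = "(\<lambda>i. cis (\<phi> i)) ` I" and ?L = "(\<lambda>i. cis (- \<phi> i)) ` I"
  have cos: "i = k" if "i \<in> I" "k \<in> I" "cos (\<phi> i) = cos (\<phi> k)" for i k
  proof -
    have "\<phi> i = \<phi> k"
      using assms(1)[OF that(1)] assms(1)[OF that(2)] that(3) by (auto intro: cos_inj_pi[where x = "\<phi> i" and y = "\<phi> k"])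
    then show ?thesis using assms(2) that by (auto dest: inj_onD)
  qed
  have inj: "inj_on (\<lambda>i. cis (\<phi> i)) I" "inj_on (\<lambda>i. cis (- \<phi> i)) I"
    by (rule inj_onI, erule (1) cos, simp add: complex_eq_iff)+
  have sin: "sin (\<phi> i) > 0" if "i \<in> I" for i using assms(1)[OF that] by (auto intro: sin_gt_zero)
  have Im: "Im z > 0" if "z \<in> ?U" for z using that sin by auto
  have Im': "Im z < 0" if "z \<in> ?L" for z using that sin by auto
  have "?U \<inter> ?L = {}" using Im Im' by (meson disjoint_iff less_asym)
  moreover have "C \<inter> (?U \<union> ?L) = {}"
  proof (rule Int_emptyI)
    fix z assume z: "z \<in> C" "z \<in> ?U \<union> ?L"
    then have "Im z = 0" using assms(4) by auto
    then show False using z(2) Im[of z] Im'[of z] by (elim UnE) simp_all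
  qed
  moreover have "finite C" using assms(4) finite_subset by blast
  ultimately have "card (C \<union> (?U \<union> ?L)) = card C + (card ?U + card ?L)"
    using assms(3) by (simp add: card_Un_disjoint)
  moreover have "(\<Union>i\<in>I. {cis (\<phi> i), cis (- \<phi> i)}) = ?U \<union> ?L" by auto
  ultimately show ?thesis by (simp add: card_image inj)
qed

text \<open>Iterating the Gronwall estimate, uniformly in \<open>n\<close>, gives the factor \<open>(6 t)\<^sup>j / j!\<close> for
  every \<open>j\<close>.\<close>

lemma schur_flow_unique:
  fixes f g :: "nat \<Rightarrow> real \<Rightarrow> complex"
  defines "F \<equiv> \<lambda>u n t. (1 - of_real ((norm (u n t))\<^sup>2)) * (u (Suc n) t - (if n = 0 then -1 else u (n - 1) t))"
  assumes f: "\<And>n t. (f n has_vector_derivative F f n t) (at t)" "\<And>n t. norm (f n t) \<le> 1"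
    and g: "\<And>n t. (g n has_vector_derivative F g n t) (at t)" "\<And>n t. norm (g n t) \<le> 1"
    and init: "\<And>n. f n 0 = g n 0" and "t \<ge> 0"
  shows "f n t = g n t"
proof -
  have lip: "norm (F f n t - F g n t) \<le> 6 * D"
    if D: "\<And>n. norm (f n t - g n t) \<le> D" for n t D
  proof -
    define p where "p u = (if n = 0 then - 1 else u (n - 1) t)" for u :: "nat \<Rightarrow> real \<Rightarrow> complex"
    define \<rho> where "\<rho> u = complex_of_real (1 - (norm (u n t))\<^sup>2)" for u :: "nat \<Rightarrow> real \<Rightarrow> complex"
    have D0: "0 \<le> D" using D[of n] norm_ge_zero order_trans by blast
    have p: "norm (p f - p g) \<le> D" using D[of "n - 1"] D0 by (simp add: p_def)
    have pf: "norm (p f) \<le> 1" using f(2) by (simp add: p_def)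
    have \<rho>g: "norm (\<rho> g) \<le> 1" unfolding \<rho>_def norm_of_real
      using g(2)[of n t] by (simp add: power_le_one abs_le_iff)
    have "norm (\<rho> f - \<rho> g) = \<bar>norm (g n t) - norm (f n t)\<bar> * (norm (g n t) + norm (f n t))"
    proof -
      have "\<rho> f - \<rho> g = of_real ((norm (g n t) - norm (f n t)) * (norm (g n t) + norm (f n t)))"
        by (simp add: \<rho>_def power2_eq_square algebra_simps)
      then show ?thesis by (simp only: norm_of_real abs_mult) simp
    qed
    also have "\<dots> \<le> D * 2"
      using D[of n] f(2)[of n t] g(2)[of n t] D0 norm_triangle_ineq3[of "g n t" "f n t"]
      by (intro mult_mono) (auto simp: norm_minus_commute)
    finally have \<rho>: "norm (\<rho> f - \<rho> g) \<le> D * 2" .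
    \<comment> \<open>The difference of two products: the first factor changes by at most 2D and
      meets a difference of size at most 2, while the second changes by at most 2D and meets a
      factor of size at most 1. This is the constant 6 = 4 + 2.\<close>
    have "F f n t - F g n t = (\<rho> f - \<rho> g) * (f (Suc n) t - p f) + \<rho> g * ((f (Suc n) t - g (Suc n) t) - (p f - p g))"
      by (simp add: F_def \<rho>_def p_def algebra_simps)
    also have "norm \<dots> \<le> D * 2 * 2 + 1 * (D + D)"
    proof (rule norm_triangle_mono)
      have "norm (f (Suc n) t - p f) \<le> 2"
        using norm_triangle_ineq4[of "f (Suc n) t" "p f"] f(2)[of "Suc n" t] pf by linarith
      then show "norm ((\<rho> f - \<rho> g) * (f (Suc n) t - p f)) \<le> D * 2 * 2"
        unfolding norm_mult using \<rho> D0 by (intro mult_mono) auto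
      have "norm (f (Suc n) t - g (Suc n) t - (p f - p g)) \<le> D + D"
        using norm_triangle_ineq4[of "f (Suc n) t - g (Suc n) t" "p f - p g"] D[of "Suc n"] p by linarith
      then show "norm (\<rho> g * (f (Suc n) t - g (Suc n) t - (p f - p g))) \<le> 1 * (D + D)"
        unfolding norm_mult using \<rho>g D0 by (intro mult_mono) auto
    qed
    finally show ?thesis by simp
  qed
  \<comment> \<open>The start \<open>j = 0\<close> is the a priori bound 2 = 1 + 1. The index
    \<open>n\<close> stays arbitrary because the equation couples it to its two neighbours.\<close>
  have est: "norm (f n t - g n t) \<le> 2 * 6 ^ j * t ^ j / fact j" if "t \<ge> 0" for n t j
    using that
  proof (induction j arbitrary: n t)
    case 0
    then show ?case using norm_triangle_ineq4[of "f n t" "g n t"] f(2)[of n t] g(2)[of n t] by simp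
  next
    case (Suc j)
    have "norm (f n t - g n t) \<le> 6 * (2 * 6 ^ j) * t ^ Suc j / fact (Suc j)"
    proof (rule vector_derivative_power_bound)
      show "((\<lambda>t. f n t - g n t) has_vector_derivative F f n t - F g n t) (at t)" for t
        by (intro has_vector_derivative_diff f(1) g(1))
      show "norm (F f n t - F g n t) \<le> 6 * (2 * 6 ^ j * t ^ j / fact j)" if "t \<ge> 0" for t
        by (rule lip, rule Suc.IH, rule that)
    qed (use Suc.prems init in auto)
    then show ?case by (simp add: mult_ac)
  qed
  have "(\<lambda>j. 2 * ((6 * t) ^ j / fact j)) \<longlonglongrightarrow> 2 * 0"
    using summable_LIMSEQ_zero[OF summable_exp[of "6 * t"]]
    by (intro tendsto_mult tendsto_const) (simp add: field_simps)
  then have "norm (f n t - g n t) \<le> 2 * 0"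
    by (rule LIMSEQ_le_const) (use est[OF \<open>t \<ge> 0\<close>] in \<open>auto simp: power_mult_distrib mult.assoc\<close>)
  then show ?thesis by simp
qed

text \<open>If the derivative stays above some m > b from T on, then g t - m t is nondecreasing
  there and g outgrows every line of slope b.\<close>

lemma derivative_limit_le_growth:
  fixes g k :: "real \<Rightarrow> real"
  assumes d: "\<And>t. t \<ge> 0 \<Longrightarrow> (g has_real_derivative k t) (at t)"
    and k: "(k \<longlongrightarrow> l) at_top"
    and b: "\<And>t. t \<ge> 0 \<Longrightarrow> g t \<le> C + b * t"
  shows "l \<le> b"
proof (rule ccontr)
  assume "\<not> l \<le> b"
  define m where "m = (l + b) / 2"
  have m: "b < m" "m < l" using \<open>\<not> l \<le> b\<close> by (auto simp: m_def)
  obtain T0 where T0: "\<And>t. t \<ge> T0 \<Longrightarrow> k t > m"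
    using order_tendstoD(1)[OF k m(2)] by (auto simp: eventually_at_top_linorder)
  define T where "T = max T0 0"
  have lower: "g T - m * T \<le> g t - m * t" if "t \<ge> T" for t
  proof (rule DERIV_nonneg_imp_nondecreasing[OF that])
    fix x assume "T \<le> x" "x \<le> t"
    then have "((\<lambda>t. g t - m * t) has_real_derivative k x - m) (at x)"
      by (auto intro!: derivative_eq_intros d simp: T_def)
    then show "\<exists>y. ((\<lambda>t. g t - m * t) has_real_derivative y) (at x) \<and> 0 \<le> y"
      using T0[of x] \<open>T \<le> x\<close> by (intro exI[of _ "k x - m"]) (auto simp: T_def)
  qed
  \<comment> \<open>Large enough that (m - b) t exceeds C - g T + m T by 1, which contradicts the
    bound on \<open>g\<close>.\<close>
  define t where "t = max T ((C - g T + m * T + 1) / (m - b))"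
  have "t \<ge> T" "t \<ge> 0" by (auto simp: t_def T_def)
  have "C - g T + m * T + 1 \<le> t * (m - b)"
    using m by (simp add: pos_divide_le_eq[symmetric] t_def)
  then show False using lower[OF \<open>t \<ge> T\<close>] b[OF \<open>t \<ge> 0\<close>] by (simp add: algebra_simps)
qed

text \<open>Over a window of fixed length h the convergent \<open>f\<close> eventually moves very
  little, so \<open>k\<close> is small somewhere in the window; the bound on \<open>k'\<close>
  carries this back to the left end.\<close>

lemma barbalat:
  fixes f k k' :: "real \<Rightarrow> real"
  assumes d: "\<And>t. (f has_real_derivative k t) (at t)" "\<And>t. (k has_real_derivative k' t) (at t)"
    and M: "\<And>t. \<bar>k' t\<bar> \<le> M" and f: "(f \<longlongrightarrow> l) at_top"
  shows "(k \<longlongrightarrow> 0) at_top"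
proof (rule tendstoI)
  fix \<epsilon> :: real assume \<epsilon>: "\<epsilon> > 0"
  have M0: "M \<ge> 0" using M[of 0] by linarith
  \<comment> \<open>Makes M h < \<epsilon> / 2; the summand 1 covers \<open>M = 0\<close>.\<close>
  define h where "h = \<epsilon> / (2 * (M + 1))"
  have h: "h > 0" using \<epsilon> M0 by (simp add: h_def)
  have Mh: "M * h < \<epsilon> / 2"
    using \<epsilon> M0 by (simp add: h_def divide_simps)
  have "((\<lambda>t. f (t + h)) \<longlongrightarrow> l) at_top"
    by (rule filterlim_compose[OF f]) (subst add.commute, rule filterlim_tendsto_add_at_top[OF tendsto_const filterlim_ident])
  then have "((\<lambda>t. f (t + h) - f t) \<longlongrightarrow> l - l) at_top" by (intro tendsto_diff f)
  then have "\<forall>\<^sub>F t in at_top. \<bar>f (t + h) - f t\<bar> < h * \<epsilon> / 2"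
    using tendstoD[of "\<lambda>t. f (t + h) - f t" 0 at_top "h * \<epsilon> / 2"] h \<epsilon> by simp
  then show "\<forall>\<^sub>F t in at_top. dist (k t) 0 < \<epsilon>"
  proof eventually_elim
    case (elim t)
    obtain \<xi> where \<xi>: "t < \<xi>" "\<xi> < t + h" "f (t + h) - f t = (t + h - t) * k \<xi>"
      using MVT2[of t "t + h" f k] d(1) h by auto
    obtain \<zeta> where \<zeta>: "k \<xi> - k t = (\<xi> - t) * k' \<zeta>"
      using MVT2[of t \<xi> k k'] d(2) \<xi>(1) by auto
    have "\<bar>k \<xi> - k t\<bar> \<le> h * M"
      unfolding \<zeta> abs_mult using \<xi> M h by (intro mult_mono) auto
    moreover have "h * \<bar>k \<xi>\<bar> < h * (\<epsilon> / 2)" using elim \<xi>(3) h by (simp add: abs_mult)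
    then have "\<bar>k \<xi>\<bar> < \<epsilon> / 2" using h by simp
    ultimately show ?case using Mh by (simp add: mult.commute)
  qed
qed

section \<open>Dynamics of the Schur flow\<close>

text \<open>At n = 0 the truncated index \<open>n - 1\<close> is 0 again, which is harmless: the
  factor 1 - (e 0)^2 vanishes. The bound is not strict because of e 0 = -1.\<close>

locale bounded_schur_flow =
  fixes e :: "nat \<Rightarrow> real \<Rightarrow> real"
  assumes e0: "e 0 t = -1"
    and flow: "(e n has_real_derivative (1 - (e n t)\<^sup>2) * (e (Suc n) t - e (n - 1) t)) (at t)"
    and bound: "\<bar>e n t\<bar> \<le> 1"
begin

lemma sum_products_derivative:
  "((\<lambda>t. - (\<Sum>j<n. e j t * e (Suc j) t)) has_real_derivative
     (1 - (e n t)\<^sup>2) * (1 - e (n - 1) t * e (Suc n) t)) (at t)"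
proof (induction n)
  case 0
  then show ?case by (simp add: e0)
next
  case (Suc n)
  show ?case unfolding sum.lessThan_Suc minus_add_distrib
    by (rule DERIV_cong[OF DERIV_add[OF Suc DERIV_minus[OF DERIV_mult[OF flow flow]]]])
       (simp add: power2_eq_square algebra_simps)
qed

lemma sum_products_convergent: "\<exists>l. ((\<lambda>t. - (\<Sum>j<n. e j t * e (Suc j) t)) \<longlongrightarrow> l) at_top"
proof -
  let ?S = "\<lambda>t. - (\<Sum>j<n. e j t * e (Suc j) t)"
  have prod: "\<bar>e j t * e i t\<bar> \<le> 1" for i j t
    using mult_mono[OF bound[of j t] bound[of i t]] by (simp add: abs_mult)
  have "mono ?S"
  proof (rule monoI)
    fix s t :: real assume "s \<le> t"
    then show "?S s \<le> ?S t"
    proof (rule DERIV_nonneg_imp_nondecreasing)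
      fix x
      have "0 \<le> (1 - (e n x)\<^sup>2) * (1 - e (n - 1) x * e (Suc n) x)"
        using bound[of n x] prod[of "n - 1" x "Suc n"]
        by (intro mult_nonneg_nonneg) (auto simp: abs_le_iff abs_square_le_1)
      then show "\<exists>y. (?S has_real_derivative y) (at x) \<and> 0 \<le> y"
        using sum_products_derivative by blast
    qed
  qed
  have "?S t \<le> real n" for t
  proof -
    have "\<bar>?S t\<bar> \<le> (\<Sum>j<n. \<bar>e j t * e (Suc j) t\<bar>)" by (simp add: sum_abs)
    also have "\<dots> \<le> (\<Sum>j<n. 1)" by (intro sum_mono prod)
    finally show ?thesis by simp
  qed
  then have le: "\<forall>i. ?S (real i) \<le> real n" by blast
  \<comment> \<open>Convergence along the integers extends to real t by monotonicity.\<close>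
  have inc: "incseq (\<lambda>i. ?S (real i))"
    by (rule monoI, rule monoD[OF \<open>mono ?S\<close>]) simp
  obtain l where "(\<lambda>i. ?S (real i)) \<longlonglongrightarrow> l"
    by (rule incseq_convergent[OF inc le])
  then show ?thesis using tendsto_at_topI_sequentially_real[OF \<open>mono ?S\<close>] by blast
qed

lemma product_convergent: "\<exists>l. ((\<lambda>t. e n t * e (Suc n) t) \<longlongrightarrow> l) at_top"
proof -
  obtain a where a: "((\<lambda>t. - (\<Sum>j<n. e j t * e (Suc j) t)) \<longlongrightarrow> a) at_top"
    using sum_products_convergent by blast
  obtain b where b: "((\<lambda>t. - (\<Sum>j<Suc n. e j t * e (Suc j) t)) \<longlongrightarrow> b) at_top"
    using sum_products_convergent by blast
  from tendsto_diff[OF a b] show ?thesis by auto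
qed

lemma tendsto_second_factor:
  assumes "(e n \<longlongrightarrow> s) at_top" "s \<noteq> 0" "((\<lambda>t. e n t * e (Suc n) t) \<longlongrightarrow> l) at_top"
  shows "(e (Suc n) \<longlongrightarrow> l / s) at_top"
proof (rule Lim_transform_eventually)
  show "((\<lambda>t. e n t * e (Suc n) t / e n t) \<longlongrightarrow> l / s) at_top"
    by (intro tendsto_divide assms)
  show "\<forall>\<^sub>F t in at_top. e n t * e (Suc n) t / e n t = e (Suc n) t"
    using tendsto_imp_eventually_ne[OF assms(1,2)] by eventually_elim simp
qed

text \<open>Since s is 1 or -1, dividing the first product limit by s gives -s y; dividing the
  second by -s y gives s back. The second division fails for y = 0, the case theta = pi / 2.\<close>

lemma tendsto_two_steps:
  assumes s: "(e n \<longlongrightarrow> s) at_top" "s * s = 1"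
    and p: "((\<lambda>t. e n t * e (Suc n) t) \<longlongrightarrow> - y) at_top"
      "((\<lambda>t. e (Suc n) t * e (Suc (Suc n)) t) \<longlongrightarrow> - y) at_top"
  shows "(e (Suc n) \<longlongrightarrow> - s * y) at_top" "(e (Suc (Suc n)) \<longlongrightarrow> s) at_top"
proof -
  have s0: "s \<noteq> 0" and inv: "1 / s = s" using s(2) by (auto simp: divide_simps)
  have "- y / s = - s * y" using inv by (simp add: divide_inverse mult.commute)
  then show 1: "(e (Suc n) \<longlongrightarrow> - s * y) at_top"
    using tendsto_second_factor[OF s(1) s0 p(1)] by simp
  show "(e (Suc (Suc n)) \<longlongrightarrow> s) at_top"
  proof (cases "y = 0")
    case False
    have "- y / (- s * y) = s" using False inv by simp
    then show ?thesis using tendsto_second_factor[OF 1 _ p(2)] False s0 by simp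
  next
    case True
    \<comment> \<open>The right-hand side of the flow for \<open>e (Suc n)\<close>, and below its
      derivative along the flow; all factors are bounded, as Barbalat's lemma requires.\<close>
    define k where "k t = (1 - (e (Suc n) t)\<^sup>2) * (e (Suc (Suc n)) t - e n t)" for t
    define k' where "k' t = - (2 * (e (Suc n) t * k t)) * (e (Suc (Suc n)) t - e n t) + (1 - (e (Suc n) t)\<^sup>2) *
        ((1 - (e (Suc (Suc n)) t)\<^sup>2) * (e (Suc (Suc (Suc n))) t - e (Suc n) t) - (1 - (e n t)\<^sup>2) * (e (Suc n) t - e (n - 1) t))" for t
    have d1: "(e (Suc n) has_real_derivative k t) (at t)" for t
      using flow[of "Suc n" t] by (simp add: k_def)
    have d2: "(k has_real_derivative k' t) (at t)" for t
      unfolding k_def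
      by (rule DERIV_cong, (rule derivative_intros d1 flow)+) (simp add: k'_def k_def)
    have diff: "\<bar>e i t - e j t\<bar> \<le> 2" for i j t using bound[of i t] bound[of j t] by linarith
    have \<rho>: "\<bar>1 - (e i t)\<^sup>2\<bar> \<le> 1" for i t
      using bound[of i t] by (simp add: abs_le_iff abs_square_le_1)
    have \<rho>d: "\<bar>(1 - (e m t)\<^sup>2) * (e i t - e j t)\<bar> \<le> 1 * 2" for m i j t
      unfolding abs_mult by (intro mult_mono diff \<rho>) auto
    have M: "\<bar>k' t\<bar> \<le> 2 * (1 * 2) * 2 + 1 * (1 * 2 + 1 * 2)" for t
    proof -
      have "\<bar>k t\<bar> \<le> 1 * 2" unfolding k_def by (rule \<rho>d)
      then have "\<bar>- (2 * (e (Suc n) t * k t)) * (e (Suc (Suc n)) t - e n t)\<bar> \<le> 2 * (1 * 2) * 2"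
        unfolding abs_mult abs_minus_cancel by (intro mult_mono diff bound) auto
      moreover have "\<bar>(1 - (e (Suc n) t)\<^sup>2) *
        ((1 - (e (Suc (Suc n)) t)\<^sup>2) * (e (Suc (Suc (Suc n))) t - e (Suc n) t) - (1 - (e n t)\<^sup>2) * (e (Suc n) t - e (n - 1) t))\<bar>
        \<le> 1 * (1 * 2 + 1 * 2)"
        unfolding abs_mult[of "1 - (e (Suc n) t)\<^sup>2"]
        by (intro mult_mono \<rho> order_trans[OF abs_triangle_ineq4] add_mono \<rho>d) auto
      ultimately show ?thesis unfolding k'_def by (meson abs_triangle_ineq add_mono order_trans)
    qed
    have k: "(k \<longlongrightarrow> 0) at_top" by (rule barbalat[OF d1 d2 M 1])
    \<comment> \<open>Here \<open>e (Suc n)\<close> tends to 0, so the prefactor in \<open>k\<close>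
      tends to 1 and the difference of the two neighbours tends to 0 along with
      \<open>k\<close>.\<close>
    have "((\<lambda>t. 1 - (e (Suc n) t)\<^sup>2) \<longlongrightarrow> 1) at_top"
      using 1 True by (auto intro!: tendsto_eq_intros)
    note \<rho>1 = this
    have "((\<lambda>t. k t / (1 - (e (Suc n) t)\<^sup>2) + e n t) \<longlongrightarrow> s) at_top"
      using tendsto_add[OF tendsto_divide[OF k \<rho>1] s(1)] by simp
    moreover have "\<forall>\<^sub>F t in at_top. k t / (1 - (e (Suc n) t)\<^sup>2) + e n t = e (Suc (Suc n)) t"
      using tendsto_imp_eventually_ne[OF \<rho>1, of 0, simplified] by eventually_elim (simp add: k_def)
    ultimately show ?thesis by (rule Lim_transform_eventually)
  qed
qed

text \<open>Each x j is the limit for two consecutive products. The starting index will be 0 if 1 is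
  not an isolated point of the support, and 1 if it is.\<close>

lemma tendsto_alternating:
  assumes s: "(e k \<longlongrightarrow> s) at_top" "s * s = 1"
    and p: "\<And>j. ((\<lambda>t. e (k + 2 * j) t * e (Suc (k + 2 * j)) t) \<longlongrightarrow> - x j) at_top"
      "\<And>j. ((\<lambda>t. e (Suc (k + 2 * j)) t * e (Suc (Suc (k + 2 * j))) t) \<longlongrightarrow> - x j) at_top"
  shows "(e (k + 2 * j) \<longlongrightarrow> s) at_top" "(e (Suc (k + 2 * j)) \<longlongrightarrow> - s * x j) at_top"
proof -
  show *: "(e (k + 2 * j) \<longlongrightarrow> s) at_top" for j
  proof (induction j)
    case (Suc j)
    then show ?case using tendsto_two_steps(2)[OF Suc s(2) p] by simp
  qed (use s in simp)
  show "(e (Suc (k + 2 * j)) \<longlongrightarrow> - s * x j) at_top"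
    by (rule tendsto_two_steps(1)[OF * s(2) p])
qed

end

section \<open>Orthogonal polynomials for the weights \<open>exp (2 t Re z) d\<mu>\<close>\<close>

text \<open>Infinite support is nontriviality: no nonzero polynomial vanishes on it, so the inner
  product below is definite.\<close>

locale circle_measure = prob_space \<mu> for \<mu> :: "complex measure" +
  assumes sets_borel: "sets \<mu> = sets borel"
    and emeasure_sphere: "emeasure \<mu> (sphere 0 1) = 1"
    and infinite_msupp: "infinite (msupp \<mu>)"
begin

lemma measurable_continuous:
  fixes f :: "complex \<Rightarrow> 'b::topological_space"
  assumes "continuous_on UNIV f"
  shows "f \<in> borel_measurable \<mu>"
  using borel_measurable_continuous_onI[OF assms] measurable_cong_sets[OF sets_borel refl] by blast

lemma AE_sphere: "AE z in \<mu>. norm z = 1"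
proof -
  have "AE z in \<mu>. z \<in> sphere 0 1"
    by (subst AE_in_set_eq_1)
       (use emeasure_sphere in \<open>auto simp: sets_borel measure_def\<close>)
  then show ?thesis by simp
qed

text \<open>The complement of the support is a union of null balls, and by Lindelof countably many
  of them cover it.\<close>

lemma AE_msupp: "AE z in \<mu>. z \<in> msupp \<mu>"
proof -
  define F where "F = {ball z e | z e. emeasure \<mu> (ball z e) = 0}"
  obtain F' where F': "F' \<subseteq> F" "countable F'" "\<Union>F' = \<Union>F"
    using Lindelof[of F] by (auto simp: F_def)
  have "(\<Union>B\<in>F'. B) \<in> null_sets \<mu>"
  proof (rule null_sets_UN')
    show "countable F'" by fact
    fix B assume "B \<in> F'"
    then show "B \<in> null_sets \<mu>" using F'(1)
      by (auto simp: F_def null_sets_def sets_borel)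
  qed
  then have "\<Union>F \<in> null_sets \<mu>" using F'(3) by simp
  moreover have "{z \<in> space \<mu>. z \<notin> msupp \<mu>} \<subseteq> \<Union>F"
  proof
    fix z assume "z \<in> {z \<in> space \<mu>. z \<notin> msupp \<mu>}"
    then obtain e where "e > 0" "emeasure \<mu> (ball z e) = 0"
      by (auto simp: msupp_def)
    then show "z \<in> \<Union>F" unfolding F_def by (auto intro!: exI[of _ "ball z e"])
  qed
  ultimately show ?thesis by (auto intro: AE_I')
qed

lemma msupp_sphere: "msupp \<mu> \<subseteq> sphere 0 1"
proof
  fix z assume z: "z \<in> msupp \<mu>"
  show "z \<in> sphere 0 1"
  proof (rule ccontr)
    assume "z \<notin> sphere 0 1"
    then have "z \<in> - sphere 0 1" by simp
    moreover have "open (- sphere (0::complex) 1)" by (simp add: open_Compl)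
    ultimately obtain e where e: "e > 0" "ball z e \<subseteq> - sphere 0 1"
      by (meson openE)
    have "AE w in \<mu>. w \<notin> ball z e"
      using AE_sphere by eventually_elim (use e in auto)
    then have "emeasure \<mu> (ball z e) = 0"
      by (subst (asm) AE_iff_measurable[where N="ball z e"]) (auto simp: sets_borel sets_eq_imp_space_eq[OF sets_borel])
    then show False using z e by (auto simp: msupp_def dest: spec[of _ e])
  qed
qed

section \<open>Weighted integrals and their derivative in time\<close>

definition wint :: "real \<Rightarrow> (complex \<Rightarrow> complex) \<Rightarrow> complex" where
  "wint t f = (LINT z|\<mu>. f z * of_real (exp (2 * t * Re z)))"

lemma continuous_bounded_sphere:
  fixes f :: "complex \<Rightarrow> complex"
  assumes "continuous_on UNIV f"
  obtains B where "B \<ge> 0" "AE z in \<mu>. norm (f z) \<le> B"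
proof -
  have "compact (f ` sphere 0 1)"
    by (intro compact_continuous_image) (use assms continuous_on_subset in auto)
  then obtain B where B: "\<And>z. z \<in> sphere 0 1 \<Longrightarrow> norm (f z) \<le> B"
    by (meson bounded_iff compact_imp_bounded imageI)
  have "AE z in \<mu>. norm (f z) \<le> max B 0"
    using AE_sphere by eventually_elim (use B in fastforce)
  then show ?thesis using that[of "max B 0"] by simp
qed

lemma integrable_continuous:
  fixes f :: "complex \<Rightarrow> complex"
  assumes "continuous_on UNIV f"
  shows "integrable \<mu> f"
  by (metis continuous_bounded_sphere[OF assms] integrable_const_bound measurable_continuous[OF assms])

lemma wint_integrable:
  assumes "continuous_on UNIV f"
  shows "integrable \<mu> (\<lambda>z. f z * complex_of_real (exp (2 * t * Re z)))"
  by (intro integrable_continuous continuous_intros assms)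

lemma wint_add:
  assumes "continuous_on UNIV f" "continuous_on UNIV g"
  shows "wint t (\<lambda>z. f z + g z) = wint t f + wint t g"
  unfolding wint_def distrib_right
  by (intro Bochner_Integration.integral_add wint_integrable assms)

lemma wint_cmult: "wint t (\<lambda>z. c * f z) = c * wint t f"
  unfolding wint_def mult.assoc by simp

lemma wint_cnj: "wint t (\<lambda>z. cnj (f z)) = cnj (wint t f)"
  proof -
  have "cnj (wint t f) = (LINT z|\<mu>. cnj (f z * of_real (exp (2 * t * Re z))))"
    unfolding wint_def by (rule Bochner_Integration.integral_cnj[symmetric])
  then show ?thesis by (simp add: wint_def)
qed

lemma wint_cong:
  assumes "continuous_on UNIV f" "continuous_on UNIV g" "\<And>z. norm z = 1 \<Longrightarrow> f z = g z"
  shows "wint t f = wint t g"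
  unfolding wint_def
  by (intro integral_cong_AE measurable_continuous continuous_intros assms)
     (use AE_sphere in \<open>eventually_elim, use assms(3) in auto\<close>)

text \<open>On the circle the second order remainder of exp (2 s Re z) is O(s^2) uniformly in z, so
  it can be integrated directly. The factor 2 Re z is written z + cnj z, to be read as
  multiplication by z in the left or in the right argument of an inner product.\<close>

lemma wint_has_derivative:
  assumes f: "continuous_on UNIV f"
  shows "((\<lambda>t. wint t f) has_vector_derivative wint t (\<lambda>z. f z * (z + cnj z))) (at t)"
proof -
  have cf: "continuous_on UNIV (\<lambda>z. f z * of_real (exp (2 * t * Re z)))"
    by (intro continuous_intros f)
  obtain B where B: "B \<ge> 0" "AE z in \<mu>. norm (f z * of_real (exp (2 * t * Re z))) \<le> B"
    using continuous_bounded_sphere[OF cf] by blast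
  define D where "D = wint t (\<lambda>z. f z * (z + cnj z))"
  have cD: "continuous_on UNIV (\<lambda>z. f z * (z + cnj z))" by (intro continuous_intros f)
  have est: "norm (wint (t + s) f - wint t f - s *\<^sub>R D) \<le> (4 * exp 2 * B) * s\<^sup>2" if s: "\<bar>s\<bar> \<le> 1" for s
  proof -
    have *: "wint (t + s) f - wint t f - s *\<^sub>R D =
        (LINT z|\<mu>. f z * of_real (exp (2 * t * Re z)) * of_real (exp (s * (2 * Re z)) - 1 - s * (2 * Re z)))"
    proof -
      have "wint (t + s) f - wint t f - s *\<^sub>R D = (LINT z|\<mu>. f z * of_real (exp (2 * (t + s) * Re z))
         - f z * of_real (exp (2 * t * Re z)) - s *\<^sub>R (f z * (z + cnj z) * of_real (exp (2 * t * Re z))))"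
        unfolding wint_def D_def
        using wint_integrable[OF f, of "t + s"] wint_integrable[OF f, of t] wint_integrable[OF cD, of t]
        by (simp add: Bochner_Integration.integral_diff)
      also have "\<dots> = (LINT z|\<mu>. f z * of_real (exp (2 * t * Re z)) * of_real (exp (s * (2 * Re z)) - 1 - s * (2 * Re z)))"
        by (intro Bochner_Integration.integral_cong refl)
           (simp add: algebra_simps exp_add scaleR_conv_of_real complex_add_cnj)
      finally show ?thesis .
    qed
    have "norm (wint (t + s) f - wint t f - s *\<^sub>R D) \<le>
      (LINT z|\<mu>. norm (f z * of_real (exp (2 * t * Re z)) * of_real (exp (s * (2 * Re z)) - 1 - s * (2 * Re z))))"
      unfolding * by (rule integral_norm_bound)
    also have "\<dots> \<le> (LINT z|\<mu>. B * (4 * exp 2 * s\<^sup>2))"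
    proof (rule integral_mono_AE)
      show "integrable \<mu> (\<lambda>z. norm (f z * of_real (exp (2 * t * Re z)) * of_real (exp (s * (2 * Re z)) - 1 - s * (2 * Re z))))"
        by (intro integrable_norm integrable_continuous continuous_intros f)
      show "integrable \<mu> (\<lambda>z. B * (4 * exp 2 * s\<^sup>2))" by simp
      show "AE z in \<mu>. norm (f z * of_real (exp (2 * t * Re z)) * of_real (exp (s * (2 * Re z)) - 1 - s * (2 * Re z)))
          \<le> B * (4 * exp 2 * s\<^sup>2)"
        using AE_sphere B(2)
      proof eventually_elim
        case (elim z)
        have "\<bar>2 * Re z\<bar> \<le> 2" using abs_Re_le_cmod[of z] elim(1) by simp
        from exp_second_order[OF this s] elim(2) B(1) show ?case
          unfolding norm_mult[of _ "of_real (exp (s * (2 * Re z)) - 1 - s * (2 * Re z))"] norm_of_real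
          by (intro mult_mono) auto
      qed
    qed
    finally show ?thesis by (simp add: prob_space mult_ac)
  qed
  have "((\<lambda>y. norm (wint y f - (wint t f + (y - t) *\<^sub>R D)) / norm (y - t)) \<longlongrightarrow> 0) (at t)"
  proof (rule Lim_null_comparison)
    show "\<forall>\<^sub>F y in at t. norm (norm (wint y f - (wint t f + (y - t) *\<^sub>R D)) / norm (y - t)) \<le> (4 * exp 2 * B) * \<bar>y - t\<bar>"
      unfolding eventually_at
    proof (intro exI[of _ 1] conjI ballI impI, simp)
      fix y assume y: "y \<noteq> t \<and> dist y t < 1"
      have "norm (wint y f - (wint t f + (y - t) *\<^sub>R D)) \<le> (4 * exp 2 * B) * \<bar>y - t\<bar> * \<bar>y - t\<bar>"
        using est[of "y - t"] y by (simp add: dist_real_def power2_eq_square diff_diff_eq abs_mult_self_eq mult.assoc)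
      then show "norm (norm (wint y f - (wint t f + (y - t) *\<^sub>R D)) / norm (y - t)) \<le> (4 * exp 2 * B) * \<bar>y - t\<bar>"
        using y by (simp add: divide_simps)
    qed
    show "((\<lambda>y. (4 * exp 2 * B) * \<bar>y - t\<bar>) \<longlongrightarrow> 0) (at t)"
      by (auto intro!: tendsto_eq_intros)
  qed
  then show ?thesis
    unfolding has_vector_derivative_def has_derivative_iff_norm D_def
    by (simp add: bounded_linear_scaleR_left diff_diff_eq)
qed

section \<open>Inner products and the Szego recursion\<close>

definition ip :: "real \<Rightarrow> complex poly \<Rightarrow> complex poly \<Rightarrow> complex" where
  "ip t p q = wint t (\<lambda>z. poly p z * cnj (poly q z))"

lemma continuous_ip: "continuous_on UNIV (\<lambda>z. poly p z * cnj (poly q z))"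
  by (intro continuous_intros)

lemma ip_cong_sphere:
  assumes "\<And>z. norm z = 1 \<Longrightarrow> poly p z * cnj (poly q z) = poly r z * cnj (poly s z)"
  shows "ip t p q = ip t r s"
  unfolding ip_def by (intro wint_cong continuous_ip assms)

lemma ip_cnj: "cnj (ip t p q) = ip t q p"
  unfolding ip_def wint_cnj[symmetric] by (simp add: mult.commute)

lemma ip_add_left: "ip t (p + r) q = ip t p q + ip t r q"
  unfolding ip_def by (simp add: distrib_right wint_add continuous_ip)

lemma ip_smult_left: "ip t (smult c p) q = c * ip t p q"
  unfolding ip_def by (simp add: mult.assoc wint_cmult)

lemma ip_zero_left [simp]: "ip t 0 q = 0"
  using ip_smult_left[of t 0 0 q] by simp

lemma ip_diff_left: "ip t (p - r) q = ip t p q - ip t r q"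
  using ip_add_left[of t "p - r" r q] by simp

lemma ip_sum_left: "ip t (\<Sum>i\<in>A. p i) q = (\<Sum>i\<in>A. ip t (p i) q)"
  by (induction A rule: infinite_finite_induct) (auto simp: ip_add_left)

lemma ip_add_right: "ip t q (p + r) = ip t q p + ip t q r"
  using arg_cong[OF ip_add_left[of t p r q], of cnj] by (simp add: ip_cnj)

lemma ip_smult_right: "ip t q (smult c p) = cnj c * ip t q p"
  using arg_cong[OF ip_smult_left[of t c p q], of cnj] by (simp add: ip_cnj)

lemma ip_sum_right: "ip t q (\<Sum>i\<in>A. p i) = (\<Sum>i\<in>A. ip t q (p i))"
  using arg_cong[OF ip_sum_left[of t p A q], of cnj] by (simp add: ip_cnj)

lemma ip_shift: "ip t (pCons 0 p) (pCons 0 q) = ip t p q"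
proof (rule ip_cong_sphere)
  fix z :: complex assume "norm z = 1"
  then have "z * cnj z = 1" by (simp add: complex_norm_square[symmetric])
  then show "poly (pCons 0 p) z * cnj (poly (pCons 0 q) z) = poly p z * cnj (poly q z)"
    by (simp add: mult_ac)
qed

lemma ip_self: "ip t p p = of_real (LINT z|\<mu>. (norm (poly p z))\<^sup>2 * exp (2 * t * Re z))"
proof -
  have "ip t p p = (LINT z|\<mu>. of_real ((norm (poly p z))\<^sup>2 * exp (2 * t * Re z)))"
    unfolding ip_def wint_def
    by (intro Bochner_Integration.integral_cong refl) (simp flip: complex_norm_square)
  then show ?thesis by (simp only: integral_complex_of_real)
qed

lemma integrable_norm_sq: "integrable \<mu> (\<lambda>z. (norm (poly p z))\<^sup>2 * exp (2 * t * Re z))"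
proof -
  have "integrable \<mu> (\<lambda>z. norm (poly p z * poly p z * of_real (exp (2 * t * Re z))))"
    by (intro integrable_norm integrable_continuous continuous_intros)
  then show ?thesis by (simp add: norm_mult power2_eq_square)
qed

lemma ip_self_nonneg: "Re (ip t p p) \<ge> 0" and ip_self_real: "ip t p p = of_real (Re (ip t p p))"
  unfolding ip_self by (auto intro!: integral_nonneg_AE)

text \<open>A vanishing norm makes p zero almost everywhere. But some support point is not among the
  finitely many roots, and a ball around it, free of roots, has positive mass.\<close>

lemma ip_self_pos:
  assumes "p \<noteq> 0"
  shows "Re (ip t p p) > 0"
proof (rule ccontr)
  assume "\<not> Re (ip t p p) > 0"
  then have "(LINT z|\<mu>. (norm (poly p z))\<^sup>2 * exp (2 * t * Re z)) = 0"
    using ip_self_nonneg[of t p] by (simp only: ip_self Re_complex_of_real)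
  then have "AE z in \<mu>. (norm (poly p z))\<^sup>2 * exp (2 * t * Re z) = 0"
    by (subst (asm) integral_nonneg_eq_0_iff_AE) (auto simp: integrable_norm_sq)
  then have ae: "AE z in \<mu>. poly p z = 0" by simp
  obtain w where w: "w \<in> msupp \<mu>" "poly p w \<noteq> 0"
    using infinite_msupp poly_roots_finite[OF assms]
    by (metis (mono_tags, lifting) finite_subset mem_Collect_eq subsetI)
  have "open {z. poly p z \<noteq> 0}"
    by (intro open_Collect_neq continuous_intros)
  then obtain e where e: "e > 0" "ball w e \<subseteq> {z. poly p z \<noteq> 0}"
    using w(2) by (metis mem_Collect_eq openE)
  have "AE z in \<mu>. z \<notin> ball w e"
    using ae by eventually_elim (use e in auto)
  then have "emeasure \<mu> (ball w e) = 0"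
    by (subst (asm) AE_iff_measurable[where N="ball w e"]) (auto simp: sets_borel sets_eq_imp_space_eq[OF sets_borel])
  then show False using w(1) e(1) by (auto simp: msupp_def dest: spec[of _ e])
qed

lemma ip_eq_sum_right:
  assumes "degree q \<le> n"
  shows "ip t p q = (\<Sum>k\<le>n. cnj (coeff q k) * ip t p (monom 1 k))"
  by (subst poly_eq_sum_smult_monom[OF assms]) (simp add: ip_sum_right ip_smult_right)

text \<open>The pair consists of the monic orthogonal polynomial of the weight
  \<open>exp (2 t Re z) d\<mu>\<close> and its reversed polynomial, generated by the Szego recursion.\<close>

primrec szego :: "real \<Rightarrow> nat \<Rightarrow> complex poly \<times> complex poly" where
  "szego t 0 = (1, 1)"
| "szego t (Suc n) = (let (P, Q) = szego t n; a = cnj (ip t (pCons 0 P) 1 / ip t Q 1)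
     in (pCons 0 P - smult (cnj a) Q, Q - smult a (pCons 0 P)))"

definition Phi where "Phi t n = fst (szego t n)"
definition Psi where "Psi t n = snd (szego t n)"
text \<open>The quotient is what makes the next \<open>Phi\<close> orthogonal to 1; orthogonality to
  the other powers is inherited from the previous step.\<close>

definition verb :: "real \<Rightarrow> nat \<Rightarrow> complex" where
  "verb t n = cnj (ip t (pCons 0 (Phi t n)) 1 / ip t (Psi t n) 1)"

lemma Phi_0 [simp]: "Phi t 0 = 1" and Psi_0 [simp]: "Psi t 0 = 1"
  by (simp_all add: Phi_def Psi_def)

lemma Phi_Suc: "Phi t (Suc n) = pCons 0 (Phi t n) - smult (cnj (verb t n)) (Psi t n)"
  and Psi_Suc: "Psi t (Suc n) = Psi t n - smult (verb t n) (pCons 0 (Phi t n))"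
  by (simp_all add: Phi_def Psi_def verb_def case_prod_beta Let_def)

lemma degree_Psi: "degree (Psi t n) \<le> n" and degree_Phi: "degree (Phi t n) = n"
  and coeff_Phi: "coeff (Phi t n) n = 1"
proof (induction n)
  case (Suc n)
  have c: "coeff (Phi t (Suc n)) (Suc n) = 1"
    using Suc.IH by (simp add: Phi_Suc coeff_eq_0)
  case 1
  have "degree (smult (verb t n) (pCons 0 (Phi t n))) \<le> Suc n"
    using degree_smult_le[of "verb t n" "pCons 0 (Phi t n)"] degree_pCons_le[of 0 "Phi t n"] Suc.IH(2)
    by linarith
  then show ?case unfolding Psi_Suc using Suc.IH(1) by (intro degree_diff_le) auto
  case 3
  show ?case by (rule c)
  case 2
  have "degree (smult (cnj (verb t n)) (Psi t n)) \<le> Suc n"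
    using Suc.IH(1) degree_smult_le[of "cnj (verb t n)" "Psi t n"] by linarith
  moreover have "degree (pCons 0 (Phi t n)) \<le> Suc n"
    using Suc.IH(2) degree_pCons_le[of 0 "Phi t n"] by simp
  ultimately have "degree (Phi t (Suc n)) \<le> Suc n" unfolding Phi_Suc by (intro degree_diff_le)
  moreover have "degree (Phi t (Suc n)) \<ge> Suc n" using c by (intro le_degree) simp
  ultimately show ?case by simp
qed auto

lemma coeff_Psi_0: "coeff (Psi t n) 0 = 1"
  by (induction n) (auto simp: Psi_Suc)

lemma coeff_Phi_Suc_0: "coeff (Phi t (Suc n)) 0 = - cnj (verb t n)"
  by (simp add: Phi_Suc coeff_Psi_0)

lemma coeff_Psi_top: "coeff (Psi t n) n = cnj (coeff (Phi t n) 0)"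
proof (cases n)
  case (Suc m)
  then show ?thesis
    by (simp add: coeff_Phi_Suc_0 Psi_Suc coeff_Phi coeff_eq_0 degree_Psi le_less_trans[OF degree_Psi])
qed simp

text \<open>As cnj z = 1 / z on the circle, the coefficients of \<open>Psi\<close> are those of
  \<open>Phi\<close> conjugated and in reverse order. Reversal exchanges the two lines of the
  recursion, which is the induction.\<close>

lemma Psi_reversed: "norm z = 1 \<Longrightarrow> poly (Psi t n) z = z ^ n * cnj (poly (Phi t n) z)"
proof (induction n)
  case (Suc n)
  have z: "z * cnj z = 1" using Suc.prems by (simp add: complex_norm_square[symmetric])
  have zn: "z ^ n * cnj z ^ n = 1" using z by (simp flip: power_mult_distrib)
  have "z ^ n * cnj (poly (Psi t n) z) = poly (Phi t n) z"
    using Suc zn by (simp add: mult.assoc[symmetric])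
  then have *: "z ^ Suc n * cnj (poly (Psi t n) z) = z * poly (Phi t n) z"
    by (simp add: mult.assoc)
  have "z ^ Suc n * cnj (poly (Phi t (Suc n)) z) =
     (z * cnj z) * (z ^ n * cnj (poly (Phi t n) z)) - verb t n * (z ^ Suc n * cnj (poly (Psi t n) z))"
    by (simp add: Phi_Suc algebra_simps)
  also have "\<dots> = poly (Psi t (Suc n)) z"
    unfolding * z using Suc by (simp add: Psi_Suc)
  finally show ?case ..
qed simp

definition sqnorm :: "real \<Rightarrow> nat \<Rightarrow> real" where
  "sqnorm t n = Re (ip t (Phi t n) (Phi t n))"

lemma sqnorm_pos: "sqnorm t n > 0"
  unfolding sqnorm_def by (intro ip_self_pos) (metis coeff_Phi coeff_0 zero_neq_one)

text \<open>Reversal sends z^k to z^(n - k) and conjugates inner products. Hence \<open>Psi\<close>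
  is orthogonal to z, ..., z^n just as \<open>Phi\<close> is to 1, ..., z^(n - 1).\<close>

lemma ip_monom_reverse:
  assumes "\<And>z. norm z = 1 \<Longrightarrow> poly q z = z ^ n * cnj (poly p z)" "k \<le> n"
  shows "ip t q (monom 1 k) = cnj (ip t p (monom 1 (n - k)))"
  unfolding ip_cnj
proof (rule ip_cong_sphere)
  fix z :: complex assume z: "norm z = 1"
  have "z * cnj z = 1" using z by (simp add: complex_norm_square[symmetric])
  then have "z ^ k * cnj z ^ k = 1" by (simp flip: power_mult_distrib)
  moreover have "z ^ n = z ^ (n - k) * z ^ k" using assms(2) by (simp flip: power_add)
  ultimately show "poly q z * cnj (poly (monom 1 k) z) = poly (monom 1 (n - k)) z * cnj (poly p z)"
    using assms(1)[OF z] by (simp add: poly_monom mult_ac)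
qed

lemma orthogonal_Phi: "k < n \<Longrightarrow> ip t (Phi t n) (monom 1 k) = 0"
proof (induction n arbitrary: k)
  case (Suc n)
  \<comment> \<open>The denominator in \<open>verb\<close> must be shown nonzero first: by reversal
    and the induction hypothesis it is the squared norm of \<open>Phi t n\<close>.\<close>
  have top: "ip t (Psi t n) 1 = cnj (ip t (Phi t n) (monom 1 n))"
    using ip_monom_reverse[OF Psi_reversed, of 0 n t t] by simp
  have self: "ip t (Phi t n) (Phi t n) = ip t (Phi t n) (monom 1 n)"
    by (subst ip_eq_sum_right[of "Phi t n" n])
       (auto simp: degree_Phi coeff_Phi Suc.IH lessThan_Suc_atMost[symmetric])
  have nz: "ip t (Psi t n) 1 \<noteq> 0"
    using sqnorm_pos[of t n] unfolding sqnorm_def self top by auto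
  show ?case
  proof (cases k)
    case 0
    then show ?thesis using nz
      by (simp add: Phi_Suc ip_diff_left ip_smult_left verb_def)
  next
    case (Suc j)
    have "ip t (pCons 0 (Phi t n)) (monom 1 k) = 0"
      using Suc Suc.prems Suc.IH by (simp add: monom_Suc ip_shift)
    moreover have "ip t (Psi t n) (monom 1 k) = 0"
      using ip_monom_reverse[OF Psi_reversed, of k n t t] Suc Suc.prems Suc.IH by simp
    ultimately show ?thesis by (simp add: Phi_Suc ip_diff_left ip_smult_left)
  qed
qed simp

lemma ip_Phi:
  assumes "degree q \<le> n"
  shows "ip t (Phi t n) q = cnj (coeff q n) * of_real (sqnorm t n)"
proof -
  have *: "ip t (Phi t n) q = cnj (coeff q n) * ip t (Phi t n) (monom 1 n)" if "degree q \<le> n" for q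
    by (subst ip_eq_sum_right[OF that]) (auto simp: orthogonal_Phi lessThan_Suc_atMost[symmetric])
  have "ip t (Phi t n) (monom 1 n) = of_real (sqnorm t n)"
    using *[of "Phi t n"] ip_self_real[of t "Phi t n"] by (simp add: degree_Phi coeff_Phi sqnorm_def)
  then show ?thesis using *[OF assms] by simp
qed

lemma ip_Psi_1: "ip t (Psi t n) 1 = of_real (sqnorm t n)"
  using ip_monom_reverse[OF Psi_reversed, of 0 n t t] by (simp add: ip_Phi degree_monom_le)

text \<open>Pairing with z^(n+1) in place of the polynomial itself makes both terms of the recursion
  explicit: the shifted one gives \<open>sqnorm t n\<close>, the reversed one gives it times
  |verb|^2.\<close>

lemma sqnorm_Suc: "sqnorm t (Suc n) = sqnorm t n * (1 - (norm (verb t n))\<^sup>2)"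
proof -
  have 1: "ip t (Phi t (Suc n)) (monom 1 (Suc n)) = of_real (sqnorm t (Suc n))"
    by (subst ip_Phi) (auto simp: degree_monom_le)
  have 2: "ip t (pCons 0 (Phi t n)) (monom 1 (Suc n)) = of_real (sqnorm t n)"
    by (simp add: monom_Suc ip_shift ip_Phi degree_monom_le)
  have "ip t (Psi t n) (monom 1 (Suc n)) = ip t 1 (pCons 0 (Phi t n))"
  proof (rule ip_cong_sphere)
    fix z :: complex assume z: "norm z = 1"
    then have "z * cnj z = 1" by (simp add: complex_norm_square[symmetric])
    then have "z ^ n * cnj z ^ n = 1" by (simp flip: power_mult_distrib)
    then show "poly (Psi t n) z * cnj (poly (monom 1 (Suc n)) z) = poly 1 z * cnj (poly (pCons 0 (Phi t n)) z)"
      by (simp add: Psi_reversed[OF z] poly_monom mult_ac)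
  qed
  also have "\<dots> = verb t n * of_real (sqnorm t n)"
    using sqnorm_pos[of t n] by (simp add: verb_def ip_Psi_1 ip_cnj)
  finally have "of_real (sqnorm t (Suc n)) = of_real (sqnorm t n) * (1 - cnj (verb t n) * verb t n)"
    unfolding 1[symmetric] by (simp add: Phi_Suc ip_diff_left ip_smult_left 2 algebra_simps)
  also have "\<dots> = complex_of_real (sqnorm t n * (1 - (norm (verb t n))\<^sup>2))"
    by (simp add: complex_norm_square mult.commute flip: of_real_power)
  finally show ?thesis by (simp only: of_real_eq_iff)
qed

text \<open>Such a p is orthogonal to itself. This identifies polynomials from their inner products:
  the monic orthogonal polynomial, and later the time derivative of \<open>Phi\<close>.\<close>

lemma ip_eq_0_imp_0:
  assumes "\<And>k. k \<ge> n \<Longrightarrow> coeff p k = 0" "\<And>k. k < n \<Longrightarrow> ip t p (monom 1 k) = 0"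
  shows "p = 0"
proof (rule ccontr)
  assume p: "p \<noteq> 0"
  then have "degree p < n" using assms(1)[of "degree p"] by (metis leading_coeff_0_iff not_le)
  then have "ip t p p = 0"
    by (subst ip_eq_sum_right[of p "degree p"]) (auto simp: assms(2))
  then show False using ip_self_pos[OF p, of t] by simp
qed

text \<open>Pythagoras: the difference of two monic polynomials of degree n has no z^n term, hence
  is orthogonal to \<open>Phi t n\<close>.\<close>

lemma sqnorm_le:
  assumes "degree p = n" "coeff p n = 1"
  shows "sqnorm t n \<le> Re (ip t p p)"
proof -
  define r where "r = p - Phi t n"
  have "degree r \<le> n" unfolding r_def by (intro degree_diff_le) (simp_all add: assms degree_Phi)
  then have r: "ip t (Phi t n) r = 0" by (subst ip_Phi) (auto simp: r_def assms coeff_Phi)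
  then have r': "ip t r (Phi t n) = 0" by (metis complex_cnj_zero ip_cnj)
  have "p = Phi t n + r" by (simp add: r_def)
  then have "Re (ip t p p) = sqnorm t n + Re (ip t r r)"
    by (simp add: ip_add_left ip_add_right r r' sqnorm_def)
  then show ?thesis using ip_self_nonneg[of t r] by simp
qed

lemma norm_verb_less_1: "norm (verb t n) < 1"
proof -
  have "0 < sqnorm t n * (1 - (norm (verb t n))\<^sup>2)"
    using sqnorm_pos[of t "Suc n"] by (simp only: sqnorm_Suc)
  then have "(norm (verb t n))\<^sup>2 < 1" using sqnorm_pos[of t n] by (simp add: zero_less_mult_iff)
  then show ?thesis using norm_ge_zero[of "verb t n"] by (simp add: abs_square_less_1)
qed

text \<open>At t = 0 the weight is 1. Definiteness gives the uniqueness that the description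
  operator asks for.\<close>

lemma monic_OP_eq_Phi: "monic_OP \<mu> n = Phi 0 n"
proof -
  have ip0: "integral\<^sup>L \<mu> (\<lambda>z. poly p z * cnj (z ^ k)) = ip 0 p (monom 1 k)" for p k
    by (simp add: ip_def wint_def poly_monom)
  show ?thesis unfolding monic_OP_def ip0
  proof (rule the_equality)
    show "degree (Phi 0 n) = n \<and> lead_coeff (Phi 0 n) = 1 \<and> (\<forall>k<n. ip 0 (Phi 0 n) (monom 1 k) = 0)"
      by (simp add: degree_Phi coeff_Phi orthogonal_Phi)
    fix p assume p: "degree p = n \<and> lead_coeff p = 1 \<and> (\<forall>k<n. ip 0 p (monom 1 k) = 0)"
    have "p - Phi 0 n = 0"
    proof (rule ip_eq_0_imp_0[of n _ 0])
      show "coeff (p - Phi 0 n) k = 0" if "k \<ge> n" for k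
        using p that by (cases "k = n") (auto simp: coeff_Phi degree_Phi coeff_eq_0)
      show "ip 0 (p - Phi 0 n) (monom 1 k) = 0" if "k < n" for k
        using p that by (simp add: ip_diff_left orthogonal_Phi)
    qed
    then show "p = Phi 0 n" by simp
  qed
qed

lemma verblunsky_eq_verb: "verblunsky \<mu> n = verb 0 n"
  by (simp add: verblunsky_def monic_OP_eq_Phi poly_0_coeff_0 coeff_Phi_Suc_0)

section \<open>Time derivatives and the Schur flow of the Verblunsky coefficients\<close>

lemma ip_has_derivative:
  "((\<lambda>s. ip s p q) has_vector_derivative ip t (pCons 0 p) q + ip t p (pCons 0 q)) (at t)"
proof -
  have "wint t (\<lambda>z. poly p z * cnj (poly q z) * (z + cnj z)) =
    wint t (\<lambda>z. poly (pCons 0 p) z * cnj (poly q z) + poly p z * cnj (poly (pCons 0 q) z))"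
    by (simp add: algebra_simps)
  also have "\<dots> = ip t (pCons 0 p) q + ip t p (pCons 0 q)"
    unfolding ip_def by (intro wint_add continuous_ip)
  finally show ?thesis using wint_has_derivative[OF continuous_ip, of p q t] by (simp add: ip_def)
qed

text \<open>Polynomial and weight both move; expansion in finitely many monomials reduces this to
  the ordinary product rule.\<close>

lemma ip_has_derivative_coeffs:
  assumes P: "\<And>k. ((\<lambda>s. coeff (P s) k) has_vector_derivative coeff P' k) (at t)"
    and deg: "\<And>s. degree (P s) \<le> n" "degree P' \<le> n"
  shows "((\<lambda>s. ip s (P s) q) has_vector_derivative
    ip t P' q + (ip t (pCons 0 (P t)) q + ip t (P t) (pCons 0 q))) (at t)"
proof -
  have eq: "ip s r q' = (\<Sum>k\<le>n. coeff r k * ip s (monom 1 k) q')" if "degree r \<le> n" for s r q'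
    by (subst poly_eq_sum_smult_monom[OF that]) (simp add: ip_sum_left ip_smult_left)
  have eq': "ip t (pCons 0 (P t)) q = (\<Sum>k\<le>n. coeff (P t) k * ip t (monom 1 (Suc k)) q)"
    by (subst pCons_0_eq_sum_smult_monom[OF deg(1)]) (simp add: ip_sum_left ip_smult_left)
  have "((\<lambda>s. \<Sum>k\<le>n. coeff (P s) k * ip s (monom 1 k) q) has_vector_derivative
     (\<Sum>k\<le>n. coeff (P t) k * (ip t (pCons 0 (monom 1 k)) q + ip t (monom 1 k) (pCons 0 q)) +
        coeff P' k * ip t (monom 1 k) q)) (at t)"
    by (intro has_vector_derivative_sum has_vector_derivative_mult P ip_has_derivative)
  then show ?thesis
    by (simp add: eq[OF deg(1)] eq[OF deg(2)] eq' monom_Suc sum.distrib distrib_left add_ac)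
qed

lemma ip_differentiable:
  assumes "\<And>k. (\<lambda>s. coeff (P s) k) differentiable (at t)" "\<And>s. degree (P s) \<le> n"
  shows "(\<lambda>s. ip s (P s) q) differentiable (at t)"
proof -
  obtain P' where "degree P' \<le> n" "\<And>k. ((\<lambda>s. coeff (P s) k) has_vector_derivative coeff P' k) (at t)"
    using differentiable_coeffs_poly[OF assms] by blast
  from ip_has_derivative_coeffs[OF this(2) assms(2) this(1), of q] show ?thesis
    by (rule differentiableI_vector)
qed

text \<open>Differentiability alone is settled first, along the recursion, whose denominators never
  vanish. The value of the derivative is then read off from the orthogonality relations.\<close>

lemma differentiable_Phi_Psi:
  "\<And>k. (\<lambda>s. coeff (Phi s n) k) differentiable (at t)"
  "\<And>k. (\<lambda>s. coeff (Psi s n) k) differentiable (at t)"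
  "(\<lambda>s. verb s n) differentiable (at t)"
proof -
  have shift: "(\<lambda>s. coeff (pCons 0 (P s)) k) differentiable (at t)"
    if "\<And>k. (\<lambda>s. coeff (P s) k) differentiable (at t)" for P :: "real \<Rightarrow> complex poly" and k
    using that by (cases k) auto
  have v: "(\<lambda>s. verb s n) differentiable (at t)"
    if P: "\<And>k. (\<lambda>s. coeff (Phi s n) k) differentiable (at t)"
      and Q: "\<And>k. (\<lambda>s. coeff (Psi s n) k) differentiable (at t)" for n
    unfolding verb_def
  proof (intro differentiable_cnj differentiable_divide)
    show "(\<lambda>s. ip s (pCons 0 (Phi s n)) 1) differentiable (at t)"
      by (rule ip_differentiable[where n = "Suc n"])
         (use shift[OF P] in \<open>auto simp: degree_Phi intro: order.trans[OF degree_pCons_le]\<close>)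
    show "(\<lambda>s. ip s (Psi s n) 1) differentiable (at t)"
      by (rule ip_differentiable[OF Q degree_Psi])
    show "ip t (Psi t n) 1 \<noteq> 0" using sqnorm_pos[of t n] by (simp add: ip_Psi_1)
  qed
  have "(\<forall>k. (\<lambda>s. coeff (Phi s n) k) differentiable (at t)) \<and>
    (\<forall>k. (\<lambda>s. coeff (Psi s n) k) differentiable (at t))"
  proof (induction n)
    case (Suc n)
    then show ?case unfolding Phi_Suc Psi_Suc coeff_diff coeff_smult
      by (intro conjI allI differentiable_diff differentiable_mult differentiable_cnj v shift) auto
  qed simp
  then show "\<And>k. (\<lambda>s. coeff (Phi s n) k) differentiable (at t)"
    "\<And>k. (\<lambda>s. coeff (Psi s n) k) differentiable (at t)"
    "(\<lambda>s. verb s n) differentiable (at t)" using v by auto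
qed

text \<open>The boundary value -1 lets the formula for the constant coefficient of
  \<open>Phi\<close> include \<open>Phi t 0 = 1\<close>.\<close>

definition verb_prev :: "real \<Rightarrow> nat \<Rightarrow> complex" where
  "verb_prev t n = (if n = 0 then -1 else verb t (n - 1))"

lemma coeff_Phi_0: "coeff (Phi t n) 0 = - cnj (verb_prev t n)"
  by (cases n) (auto simp: verb_prev_def coeff_Phi_Suc_0)

text \<open>The leading coefficient is constant, so the derivative has degree at most m and is
  determined by its inner products with 1, ..., z^m, which come from differentiating the
  orthogonality relations. On the right, the first and third terms are orthogonal to these powers
  and serve to cancel the two top coefficients of the second.\<close>

lemma Phi_derivative:
  assumes P': "\<And>k. ((\<lambda>s. coeff (Phi s (Suc m)) k) has_vector_derivative coeff P' k) (at t)"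
    and deg: "degree P' \<le> Suc m"
  shows "P' = Phi t (Suc (Suc m)) - pCons 0 (Phi t (Suc m)) - smult (cnj (verb t (Suc m)) * verb t m) (Phi t (Suc m))
      - smult (1 - of_real ((norm (verb t m))\<^sup>2)) (Phi t m)" (is "P' = ?R")
proof -
  have "((\<lambda>s. coeff (Phi s (Suc m)) (Suc m)) has_vector_derivative 0) (at t)"
    by (simp add: coeff_Phi)
  then have top: "coeff P' (Suc m) = 0" using P' vector_derivative_unique_at by blast
  have "P' - ?R = 0"
  proof (rule ip_eq_0_imp_0[of "Suc m" _ t])
    fix k assume k: "k \<ge> Suc m"
    consider "k = Suc m" | "k = Suc (Suc m)" | "k > Suc (Suc m)" using k by linarith
    then show "coeff (P' - ?R) k = 0"
    proof cases
      \<comment> \<open>The top coefficient of \<open>Psi t (Suc m)\<close> is the conjugate of the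
        constant one of \<open>Phi t (Suc m)\<close>, that is \<open>- verb t m\<close>; hence the
        product of two Verblunsky coefficients in the third term.\<close>
      case 1
      then show ?thesis
        by (simp add: top coeff_Phi coeff_eq_0 degree_Phi coeff_Psi_top coeff_Phi_Suc_0 Phi_Suc[of t "Suc m"])
    next
      case 2
      then show ?thesis using deg by (simp add: coeff_Phi coeff_eq_0 degree_Phi)
    next
      case 3
      then obtain j where j: "k = Suc j" "j > Suc m" by (cases k) auto
      then show ?thesis using deg by (simp add: coeff_eq_0 degree_Phi)
    qed
  next
    fix k assume k: "k < Suc m"
    have "((\<lambda>s. ip s (Phi s (Suc m)) (monom 1 k)) has_vector_derivative ip t P' (monom 1 k) +
       (ip t (pCons 0 (Phi t (Suc m))) (monom 1 k) + ip t (Phi t (Suc m)) (pCons 0 (monom 1 k)))) (at t)"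
      by (rule ip_has_derivative_coeffs[OF P' _ deg]) (simp add: degree_Phi)
    moreover have "((\<lambda>s. ip s (Phi s (Suc m)) (monom 1 k)) has_vector_derivative 0) (at t)"
      using k by (simp add: orthogonal_Phi)
    ultimately have "ip t P' (monom 1 k) + (ip t (pCons 0 (Phi t (Suc m))) (monom 1 k)
        + ip t (Phi t (Suc m)) (pCons 0 (monom 1 k))) = 0"
      using vector_derivative_unique_at by blast
    \<comment> \<open>Both sides vanish for k < m. For k = m they are the squared norms at m + 1 and
      at m, whose ratio is the prefactor.\<close>
    moreover have "ip t (Phi t (Suc m)) (pCons 0 (monom 1 k)) =
        (1 - of_real ((norm (verb t m))\<^sup>2)) * ip t (Phi t m) (monom 1 k)"
      using k by (cases "k = m")
        (auto simp: monom_Suc[symmetric] ip_Phi degree_monom_eq sqnorm_Suc[of t m])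
    moreover have "ip t (P' - ?R) (monom 1 k) = ip t P' (monom 1 k) + (ip t (pCons 0 (Phi t (Suc m))) (monom 1 k)
        + (1 - of_real ((norm (verb t m))\<^sup>2)) * ip t (Phi t m) (monom 1 k))"
      using k by (simp only: ip_diff_left ip_smult_left) (simp add: orthogonal_Phi)
    ultimately show "ip t (P' - ?R) (monom 1 k) = 0" by simp
  qed
  then show ?thesis by simp
qed

text \<open>The constant coefficient of the formula for the derivative of \<open>Phi\<close>: its
  shifted term contributes nothing there.\<close>

lemma verb_schur_flow:
  "((\<lambda>s. verb s n) has_vector_derivative
     (1 - of_real ((norm (verb t n))\<^sup>2)) * (verb t (Suc n) - verb_prev t n)) (at t)"
proof -
  obtain P' where P': "degree P' \<le> Suc n"
    "\<And>k. ((\<lambda>s. coeff (Phi s (Suc n)) k) has_vector_derivative coeff P' k) (at t)"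
    using differentiable_coeffs_poly[OF differentiable_Phi_Psi(1)[where n = "Suc n" and t = t], of "Suc n"]
    by (auto simp: degree_Phi)
  have "((\<lambda>s. - cnj (verb s n)) has_vector_derivative coeff P' 0) (at t)"
    using P'(2)[of 0] by (simp add: coeff_Phi_Suc_0)
  then have "((\<lambda>s. cnj (- (- cnj (verb s n)))) has_vector_derivative cnj (- coeff P' 0)) (at t)"
    by (intro has_vector_derivative_cnj has_vector_derivative_minus)
  moreover have "cnj (- coeff P' 0) = (1 - of_real ((norm (verb t n))\<^sup>2)) * (verb t (Suc n) - verb_prev t n)"
    unfolding Phi_derivative[OF P'(2,1)]
    by (simp add: coeff_Phi_Suc_0 coeff_Phi_0[of t n] algebra_simps)
       (simp flip: complex_norm_square)
  ultimately show ?thesis by simp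
qed

text \<open>The weight is differentiated only for n = 0. The step multiplies by 1 - |verb|^2, whose
  derivative the flow supplies.\<close>

lemma sqnorm_derivative:
  "((\<lambda>s. sqnorm s n) has_real_derivative (- 2 * Re (cnj (verb_prev t n) * verb t n) * sqnorm t n)) (at t)"
proof (induction n)
  case 0
  have "((\<lambda>s. Re (ip s 1 1)) has_vector_derivative Re (ip t (pCons 0 1) 1 + ip t 1 (pCons 0 1))) (at t)"
    by (rule bounded_linear.has_vector_derivative[OF bounded_linear_Re ip_has_derivative])
  moreover have "ip t (pCons 0 1) 1 = cnj (verb t 0) * of_real (sqnorm t 0)"
    using sqnorm_pos[of t 0] ip_Psi_1[of t 0] by (simp add: verb_def)
  moreover have "ip t 1 (pCons 0 1) = cnj (ip t (pCons 0 1) 1)" by (simp only: ip_cnj)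
  ultimately show ?case
    by (simp add: sqnorm_def verb_prev_def has_real_derivative_iff_has_vector_derivative mult.assoc)
next
  case (Suc n)
  have v: "((\<lambda>s. verb s n) has_derivative (\<lambda>h. h *\<^sub>R ((1 - of_real ((norm (verb t n))\<^sup>2)) * (verb t (Suc n) - verb_prev t n)))) (at t)"
    using verb_schur_flow unfolding has_vector_derivative_def .
  \<comment> \<open>The norm is not differentiable at 0, its square is; hence the form with real and
    imaginary parts.\<close>
  have "((\<lambda>s. (Re (verb s n))\<^sup>2 + (Im (verb s n))\<^sup>2) has_real_derivative
     2 * Re (cnj (verb t n) * ((1 - of_real ((norm (verb t n))\<^sup>2)) * (verb t (Suc n) - verb_prev t n)))) (at t)"
    unfolding has_field_derivative_def
    by (rule has_derivative_eq_rhs, (rule derivative_intros v)+) (simp add: fun_eq_iff algebra_simps)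
  then have "((\<lambda>s. (norm (verb s n))\<^sup>2) has_real_derivative
     2 * Re (cnj (verb t n) * ((1 - of_real ((norm (verb t n))\<^sup>2)) * (verb t (Suc n) - verb_prev t n)))) (at t)"
    by (simp only: cmod_power2)
  from DERIV_mult[OF Suc DERIV_diff[OF DERIV_const[of 1] this]] show ?case
    unfolding sqnorm_Suc
    by (rule DERIV_cong) (simp add: verb_prev_def[of _ "Suc n"] algebra_simps)
qed

section \<open>Growth of the norms and limits of the coefficients\<close>

lemma sqnorm_upper:
  assumes W: "finite W" "card W \<le> n" "W \<subseteq> sphere 0 1"
    and y: "\<And>z. z \<in> msupp \<mu> - W \<Longrightarrow> Re z \<le> y" and t: "t \<ge> 0"
  shows "sqnorm t n \<le> 4 ^ n * exp (2 * t * y)"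
proof -
  \<comment> \<open>The power of z pads the degree to n without changing the modulus on the circle.
    Each linear factor is at most 2 there, and squaring 2^n gives 4^n.\<close>
  define p where "p = (\<Prod>w\<in>W. [:-w, 1:]) * monom 1 (n - card W)"
  have monic: "lead_coeff (\<Prod>w\<in>W. [:-w, 1:]) = 1"
    by (simp add: lead_coeff_prod)
  have deg: "degree (\<Prod>w\<in>W. [:-w, 1:]) = card W"
    by (subst degree_prod_eq_sum_degree) auto
  have nz: "(\<Prod>w\<in>W. [:-w, 1:]) \<noteq> 0" using monic by auto
  have degp: "degree p = n"
    unfolding p_def by (subst degree_mult_eq) (use nz W(2) in \<open>auto simp: deg degree_monom_eq\<close>)
  have "lead_coeff p = 1"
    unfolding p_def lead_coeff_mult monic by (simp add: degree_monom_eq)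
  then have cp: "coeff p n = 1" by (simp add: degp)
  have bound: "norm (poly p z) \<le> 2 ^ n" if "norm z = 1" for z
  proof -
    have "norm (poly p z) = (\<Prod>w\<in>W. norm (z - w))"
      by (simp add: p_def poly_prod poly_monom norm_mult norm_power that prod_norm[symmetric] norm_minus_commute)
    also have "\<dots> \<le> (\<Prod>w\<in>W. 2)"
    proof (intro prod_mono conjI norm_ge_zero)
      fix w assume "w \<in> W"
      then have "norm w = 1" using W(3) by auto
      then show "norm (z - w) \<le> 2" using norm_triangle_ineq4[of z w] that by simp
    qed
    also have "\<dots> \<le> 2 ^ n" using W(2) by simp
    finally show ?thesis .
  qed
  have "sqnorm t n \<le> Re (ip t p p)" by (rule sqnorm_le[OF degp cp])
  also have "\<dots> = (LINT z|\<mu>. (norm (poly p z))\<^sup>2 * exp (2 * t * Re z))"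
    by (simp only: ip_self Re_complex_of_real)
  also have "\<dots> \<le> (LINT z|\<mu>. 4 ^ n * exp (2 * t * y))"
  proof (rule integral_mono_AE)
    show "AE z in \<mu>. (norm (poly p z))\<^sup>2 * exp (2 * t * Re z) \<le> 4 ^ n * exp (2 * t * y)"
      using AE_sphere AE_msupp
    proof eventually_elim
      case (elim z)
      show ?case
      proof (cases "z \<in> W")
        case True
        then have "poly p z = 0" using W(1) by (auto simp: p_def poly_prod prod_zero_iff)
        then show ?thesis by simp
      next
        case False
        have "(norm (poly p z))\<^sup>2 \<le> (2 ^ n)\<^sup>2"
          using bound[OF elim(1)] by (intro power_mono) auto
        also have "\<dots> = 4 ^ n" by (simp add: power2_eq_square flip: power_mult_distrib)
        finally show ?thesis using y[of z] False elim(2) t by (intro mult_mono) (auto intro: mult_left_mono)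
      qed
    qed
  qed (auto intro: integrable_norm_sq)
  finally show ?thesis by (simp add: prob_space)
qed

lemma sqnorm_lower:
  assumes W: "W \<subseteq> msupp \<mu>" "finite W" "card W = Suc n" and y: "\<And>w. w \<in> W \<Longrightarrow> y < Re w"
  shows "\<exists>c>0. \<forall>t\<ge>0. c * exp (2 * t * y) \<le> sqnorm t n"
proof -
  \<comment> \<open>The radius r has to meet finitely many conditions: below a quarter of all
    distances, for the pigeonhole argument, and below each \<open>Re w - y\<close>, so that the
    balls stay in the half plane Re z > y.\<close>
  have small: "\<forall>\<^sub>F r in at_right 0. r < d" if "d > 0" for d :: real
    using eventually_at_right_real[OF that] by eventually_elim simp
  have "\<forall>\<^sub>F r in at_right (0::real). \<forall>w\<in>W. \<forall>w'\<in>W. (w \<noteq> w' \<longrightarrow> r < dist w w' / 4) \<and> r < Re w - y"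
  proof (intro eventually_ball_finite W(2) ballI eventually_conj)
    fix w w' assume "w \<in> W" "w' \<in> W"
    then show "\<forall>\<^sub>F r in at_right (0::real). w \<noteq> w' \<longrightarrow> r < dist w w' / 4"
      using small[of "dist w w' / 4"] by (cases "w = w'") auto
    show "\<forall>\<^sub>F r in at_right (0::real). r < Re w - y"
      using small y \<open>w \<in> W\<close> by simp
  qed
  moreover have "\<forall>\<^sub>F r in at_right (0::real). 0 < r" by (simp add: eventually_at_right_less)
  ultimately have "\<forall>\<^sub>F r in at_right (0::real). 0 < r \<and>
      (\<forall>w\<in>W. \<forall>w'\<in>W. (w \<noteq> w' \<longrightarrow> r < dist w w' / 4) \<and> r < Re w - y)"
    by eventually_elim blast
  from eventually_happens'[OF trivial_limit_at_right_real this] obtain r where r0: "0 < r"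
      "\<forall>w\<in>W. \<forall>w'\<in>W. (w \<noteq> w' \<longrightarrow> r < dist w w' / 4) \<and> r < Re w - y"
    by blast
  have r: "0 < r" "\<And>w. w \<in> W \<Longrightarrow> r < Re w - y" using r0 by blast+
  have sep: "4 * r < dist w w'" if "w \<in> W" "w' \<in> W" "w \<noteq> w'" for w w'
    using bspec[OF bspec[OF r0(2) that(1)] that(2)] that(3) by simp
  \<comment> \<open>The minimum over all of \<open>W\<close>, because the point chosen below depends
    on t through the roots.\<close>
  define m where "m = Min ((\<lambda>w. measure \<mu> (ball w r)) ` W)"
  have W0: "W \<noteq> {}" using W(3) by auto
  have ballS: "ball w r \<in> sets \<mu>" for w by (simp add: sets_borel)
  have "measure \<mu> (ball w r) > 0" if "w \<in> W" for w
    using W(1) that r(1) by (auto simp: msupp_def emeasure_eq_measure)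
  then have m: "m > 0" unfolding m_def using W(2) W0 by simp
  show ?thesis
  proof (intro exI[of _ "m * (r ^ n)\<^sup>2"] conjI allI impI)
    show "m * (r ^ n)\<^sup>2 > 0" using m r(1) by simp
    fix t :: real assume t: "t \<ge> 0"
    obtain A where A: "size A = n" "Phi t n = (\<Prod>a\<in>#A. [:-a, 1:])"
      using alg_closed_imp_factorization[of "Phi t n"]
      by (metis coeff_0 coeff_Phi degree_Phi smult_1_left zero_neq_one)
    obtain w where w: "w \<in> W" "\<And>a. a \<in># A \<Longrightarrow> 2 * r \<le> dist w a"
      using exists_point_far_from_roots[of A W r] A(1) W(3) sep by auto
    \<comment> \<open>Roots at distance at least 2r from the centre are at distance at least r from
      every point of the ball.\<close>
    have low: "(r ^ n)\<^sup>2 * exp (2 * t * y) \<le> (norm (poly (Phi t n) z))\<^sup>2 * exp (2 * t * Re z)"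
      if z: "z \<in> ball w r" for z
    proof (intro mult_mono power_mono)
      have "r \<le> norm (z - a)" if "a \<in># A" for a
        using w(2)[OF that] z dist_triangle[of w a z] by (simp add: dist_norm)
      from norm_poly_prod_roots_ge[of A r z, OF this] r(1) show "r ^ n \<le> norm (poly (Phi t n) z)"
        by (simp add: A)
      have "\<bar>Re (w - z)\<bar> < r" using abs_Re_le_cmod[of "w - z"] z by (simp add: dist_norm)
      then have "y \<le> Re z" using r(2)[OF w(1)] by simp
      then show "exp (2 * t * y) \<le> exp (2 * t * Re z)" using t by (simp add: mult_left_mono)
    qed (use r(1) in auto)
    have "m * (r ^ n)\<^sup>2 * exp (2 * t * y) \<le> measure \<mu> (ball w r) * ((r ^ n)\<^sup>2 * exp (2 * t * y))"
      using W(2) w(1) by (auto simp: m_def mult.assoc intro!: mult_right_mono)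
    also have "\<dots> = (LINT z|\<mu>. indicator (ball w r) z * ((r ^ n)\<^sup>2 * exp (2 * t * y)))"
      using ballS[of w] by (simp add: sets.Int_space_eq2)
    also have "\<dots> \<le> (LINT z|\<mu>. (norm (poly (Phi t n) z))\<^sup>2 * exp (2 * t * Re z))"
    proof (rule integral_mono)
      show "integrable \<mu> (\<lambda>z. indicator (ball w r) z * ((r ^ n)\<^sup>2 * exp (2 * t * y)))"
        using ballS[of w] by (auto simp: emeasure_eq_measure)
      fix z show "indicator (ball w r) z * ((r ^ n)\<^sup>2 * exp (2 * t * y)) \<le> (norm (poly (Phi t n) z))\<^sup>2 * exp (2 * t * Re z)"
        using low[of z] by (auto simp: indicator_def)
    qed (rule integrable_norm_sq)
    also have "\<dots> = sqnorm t n" by (simp only: sqnorm_def ip_self Re_complex_of_real)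
    finally show "m * (r ^ n)\<^sup>2 * exp (2 * t * y) \<le> sqnorm t n" .
  qed
qed

text \<open>\<open>nth_top n y\<close> says that \<open>y\<close> is the value number \<open>n\<close> (from \<open>0\<close>) in the decreasing list of
  the real parts of the points of the support, where points of the essential support are
  repeated infinitely often.\<close>

definition nth_top :: "nat \<Rightarrow> real \<Rightarrow> bool" where
  "nth_top n y \<longleftrightarrow>
     (\<exists>W. finite W \<and> card W \<le> n \<and> W \<subseteq> sphere 0 1 \<and> (\<forall>z\<in>msupp \<mu> - W. Re z \<le> y)) \<and>
     (\<forall>b<y. \<exists>W\<subseteq>msupp \<mu>. finite W \<and> card W = Suc n \<and> (\<forall>w\<in>W. b < Re w))"

lemma limit_eq_nth_top:
  assumes "nth_top n y"
    and k: "((\<lambda>t. Re (cnj (verb_prev t n) * verb t n)) \<longlongrightarrow> l) at_top"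
  shows "l = - y"
proof -
  define g where "g t = ln (sqnorm t n)" for t
  have d: "(g has_real_derivative - 2 * Re (cnj (verb_prev t n) * verb t n)) (at t)" for t
    unfolding g_def
    by (rule DERIV_cong[OF DERIV_chain2[OF DERIV_ln sqnorm_derivative]])
       (use sqnorm_pos[of t n] in \<open>auto simp: field_simps\<close>)
  have dm: "((\<lambda>t. - g t) has_real_derivative 2 * Re (cnj (verb_prev t n) * verb t n)) (at t)" for t
    using DERIV_minus[OF d[of t]] by (simp only: mult_minus_left minus_minus)
  have lim: "((\<lambda>t. - 2 * Re (cnj (verb_prev t n) * verb t n)) \<longlongrightarrow> - 2 * l) at_top"
    "((\<lambda>t. 2 * Re (cnj (verb_prev t n) * verb t n)) \<longlongrightarrow> 2 * l) at_top"
    by (intro tendsto_intros k)+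
  obtain W where W: "finite W" "card W \<le> n" "W \<subseteq> sphere 0 1" "\<And>z. z \<in> msupp \<mu> - W \<Longrightarrow> Re z \<le> y"
    using assms(1) unfolding nth_top_def by blast
  have "- 2 * l \<le> 2 * y"
  proof (rule derivative_limit_le_growth[OF d lim(1)])
    fix t :: real assume "t \<ge> 0"
    from sqnorm_upper[OF W this] have "g t \<le> ln (4 ^ n * exp (2 * t * y))"
      unfolding g_def using sqnorm_pos[of t n] by (subst ln_le_cancel_iff) auto
    then show "g t \<le> ln (4 ^ n) + 2 * y * t" by (simp add: ln_mult mult_ac)
  qed
  \<comment> \<open>The value y may be only approached by real parts in the support, so the lower
    growth bound is applied to every b below y.\<close>
  moreover have "b \<le> - l" if b: "b < y" for b
  proof -
    from assms(1) b have "\<exists>W\<subseteq>msupp \<mu>. finite W \<and> card W = Suc n \<and> (\<forall>w\<in>W. b < Re w)"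
      unfolding nth_top_def by simp
    then obtain W where W: "W \<subseteq> msupp \<mu>" "finite W" "card W = Suc n" "\<forall>w\<in>W. b < Re w"
      by (elim exE conjE)
    obtain c where c: "c > 0" "\<And>t. t \<ge> 0 \<Longrightarrow> c * exp (2 * t * b) \<le> sqnorm t n"
      using sqnorm_lower[OF W(1-3) bspec[OF W(4)]] by blast
    have "2 * l \<le> - (2 * b)"
    proof (rule derivative_limit_le_growth[OF dm lim(2)])
      fix t :: real assume "t \<ge> 0"
      from c(2)[OF this] have "ln (c * exp (2 * t * b)) \<le> g t"
        unfolding g_def using sqnorm_pos[of t n] c(1) by (subst ln_le_cancel_iff) auto
      then show "- g t \<le> - ln c + - (2 * b) * t" using c(1) by (simp add: ln_mult mult_ac)
    qed
    then show ?thesis by simp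
  qed
  then have "y \<le> - l" by (rule dense_le)
  ultimately show ?thesis by simp
qed

section \<open>The essential support, the angle Theta and the ordered real parts\<close>

lemma closed_msupp: "closed (msupp \<mu>)"
  unfolding closed_def open_contains_ball
proof
  fix z assume "z \<in> - msupp \<mu>"
  then obtain e where e: "e > 0" "emeasure \<mu> (ball z e) = 0" by (auto simp: msupp_def)
  have "ball z e \<subseteq> - msupp \<mu>"
  proof
    fix w assume w: "w \<in> ball z e"
    then obtain d where d: "d > 0" "ball w d \<subseteq> ball z e" by (meson open_ball openE)
    then have "emeasure \<mu> (ball w d) \<le> emeasure \<mu> (ball z e)"
      by (intro emeasure_mono) (auto simp: sets_borel)
    then show "w \<in> - msupp \<mu>" using d(1) e(2) by (auto simp: msupp_def)
  qed
  then show "\<exists>e>0. ball z e \<subseteq> - msupp \<mu>" using e(1) by blast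
qed

lemma ess_suppI: "z islimpt msupp \<mu> \<Longrightarrow> z \<in> ess_supp \<mu>"
  using closed_msupp by (auto simp: ess_supp_def closed_limpt)

text \<open>An infinite subset of the compact circle accumulates. This keeps the infimum in
  \<open>Theta\<close> from ranging over the empty set.\<close>

lemma ess_supp_nonempty: "ess_supp \<mu> \<noteq> {}"
proof -
  have "compact (sphere (0::complex) 1)" by simp
  then obtain z where "z islimpt msupp \<mu>"
    using Heine_Borel_imp_Bolzano_Weierstrass[OF _ infinite_msupp msupp_sphere] by blast
  then show ?thesis using ess_suppI by blast
qed

definition ess_angles :: "real set" where
  "ess_angles = {\<bar>\<theta>\<bar> | \<theta>. -pi < \<theta> \<and> \<theta> \<le> pi \<and> cis \<theta> \<in> ess_supp \<mu>}"

lemma ess_angles_nonneg: "a \<in> ess_angles \<Longrightarrow> 0 \<le> a"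
  by (auto simp: ess_angles_def)

lemma Theta_le: "a \<in> ess_angles \<Longrightarrow> Theta \<mu> \<le> a"
  unfolding Theta_def ess_angles_def[symmetric]
  by (rule cInf_lower) (auto intro: bdd_belowI[of _ 0] ess_angles_nonneg)

lemma msupp_cis:
  assumes "z \<in> msupp \<mu>"
  obtains \<eta> where "-pi < \<eta>" "\<eta> \<le> pi" "z = cis \<eta>"
proof
  have "norm z = 1" using assms msupp_sphere by auto
  then show "z = cis (Arg z)" using cis_Arg[of z] by (cases "z = 0") (auto simp: sgn_eq)
  show "-pi < Arg z" "Arg z \<le> pi" using Arg_bounded[of z] by auto
qed

lemma ess_angles_nonempty: "ess_angles \<noteq> {}"
proof -
  obtain z where z: "z \<in> ess_supp \<mu>" using ess_supp_nonempty by blast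
  then have "z \<in> msupp \<mu>" by (simp add: ess_supp_def)
  then obtain \<eta> where "-pi < \<eta>" "\<eta> \<le> pi" "z = cis \<eta>" by (rule msupp_cis)
  then show ?thesis using z by (auto simp: ess_angles_def)
qed

lemma Theta_nonneg: "0 \<le> Theta \<mu>"
  unfolding Theta_def ess_angles_def[symmetric]
  by (rule cInf_greatest[OF ess_angles_nonempty ess_angles_nonneg])

lemma Theta_le_pi: "Theta \<mu> \<le> pi"
proof -
  obtain a where a: "a \<in> ess_angles" using ess_angles_nonempty by blast
  then have "a \<le> pi" by (auto simp: ess_angles_def)
  then show ?thesis using Theta_le[OF a] by simp
qed

text \<open>Angles of essential points come arbitrarily close to their infimum, and the cosine is
  continuous.\<close>

lemma ess_supp_near_Theta:
  assumes "b < cos (Theta \<mu>)"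
  obtains z where "z \<in> ess_supp \<mu>" "b < Re z"
proof -
  have "\<forall>\<^sub>F x in nhds (Theta \<mu>). b < cos x"
    using order_tendstoD(1)[OF isCont_cos[unfolded isCont_def] assms] assms
    by (simp add: eventually_nhds_conv_at)
  then obtain d where d: "d > 0" "\<And>x. dist x (Theta \<mu>) < d \<Longrightarrow> b < cos x"
    unfolding eventually_nhds_metric by blast
  have "Inf ess_angles < Theta \<mu> + d" using d(1) by (simp add: Theta_def ess_angles_def)
  then obtain a where a: "a \<in> ess_angles" "a < Theta \<mu> + d"
    using cInf_lessD[OF ess_angles_nonempty] by blast
  have "b < cos a" using d(2)[of a] a(2) Theta_le[OF a(1)] by (simp add: dist_real_def)
  moreover obtain \<theta> where "a = \<bar>\<theta>\<bar>" "cis \<theta> \<in> ess_supp \<mu>" using a(1) by (auto simp: ess_angles_def)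
  ultimately show thesis using that[of "cis \<theta>"] by simp
qed

text \<open>An open half plane around an accumulation point contains infinitely many support points;
  this is why an essential point counts infinitely often.\<close>

lemma ess_supp_many_points:
  assumes "z \<in> ess_supp \<mu>" "b < Re z"
  shows "\<exists>W\<subseteq>msupp \<mu>. finite W \<and> card W = n \<and> (\<forall>w\<in>W. b < Re w)"
proof -
  have "open {w. b < Re w}" by (intro open_Collect_less continuous_intros)
  then have "infinite ({w. b < Re w} \<inter> msupp \<mu>)"
    using assms by (auto simp: ess_supp_def islimpt_eq_acc_point)
  from infinite_arbitrarily_large[OF this, of n] obtain W where
    "finite W" "card W = n" "W \<subseteq> {w. b < Re w} \<inter> msupp \<mu>" by auto
  then show ?thesis by (intro exI[of _ W]) auto
qed

lemma Re_le_cos_Theta: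
  assumes "z \<in> msupp \<mu>" "z \<notin> Sset \<mu>"
  shows "Re z \<le> cos (Theta \<mu>)"
proof -
  obtain \<eta> where \<eta>: "-pi < \<eta>" "\<eta> \<le> pi" "z = cis \<eta>" using msupp_cis[OF assms(1)] .
  then have "Theta \<mu> \<le> \<bar>\<eta>\<bar>" using assms by (auto simp: Sset_def not_less)
  then have "cos \<bar>\<eta>\<bar> \<le> cos (Theta \<mu>)"
    using \<eta> Theta_nonneg by (intro cos_monotone_0_pi_le) auto
  then show ?thesis using \<eta>(3) by simp
qed

lemma Re_le_1: "z \<in> msupp \<mu> \<Longrightarrow> Re z \<le> 1"
  using msupp_sphere complex_Re_le_cmod[of z] by auto

lemma nth_top_Theta:
  assumes "finite (Sset \<mu>)" "card (Sset \<mu>) \<le> n"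
  shows "nth_top n (cos (Theta \<mu>))"
  unfolding nth_top_def
proof (intro conjI allI impI)
  have "Sset \<mu> \<subseteq> sphere 0 1" using msupp_sphere by (auto simp: Sset_def)
  then show "\<exists>W. finite W \<and> card W \<le> n \<and> W \<subseteq> sphere 0 1 \<and> (\<forall>z\<in>msupp \<mu> - W. Re z \<le> cos (Theta \<mu>))"
    using assms Re_le_cos_Theta by (intro exI[of _ "Sset \<mu>"]) auto
  fix b assume "b < cos (Theta \<mu>)"
  then obtain z where "z \<in> ess_supp \<mu>" "b < Re z" by (rule ess_supp_near_Theta)
  then show "\<exists>W\<subseteq>msupp \<mu>. finite W \<and> card W = Suc n \<and> (\<forall>w\<in>W. b < Re w)"
    by (rule ess_supp_many_points)
qed

lemma nth_top_1:
  assumes "1 \<in> ess_supp \<mu>"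
  shows "nth_top n 1"
  unfolding nth_top_def
proof (intro conjI allI impI)
  show "\<exists>W. finite W \<and> card W \<le> n \<and> W \<subseteq> sphere 0 1 \<and> (\<forall>z\<in>msupp \<mu> - W. Re z \<le> 1)"
    using Re_le_1 by (intro exI[of _ "{}"]) auto
  fix b :: real assume "b < 1"
  then show "\<exists>W\<subseteq>msupp \<mu>. finite W \<and> card W = Suc n \<and> (\<forall>w\<in>W. b < Re w)"
    using ess_supp_many_points[OF assms] by simp
qed

text \<open>For values attained in the support. \<open>V\<close> may be larger than n + 1, so that
  conjugate pairs can be included whole.\<close>

lemma nth_topI:
  assumes W: "W \<subseteq> msupp \<mu>" "finite W" "card W \<le> n" "\<And>z. z \<in> msupp \<mu> - W \<Longrightarrow> Re z \<le> y"
    and V: "V \<subseteq> msupp \<mu>" "finite V" "n < card V" "\<And>z. z \<in> V \<Longrightarrow> y \<le> Re z"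
  shows "nth_top n y"
  unfolding nth_top_def
proof (intro conjI allI impI)
  show "\<exists>W. finite W \<and> card W \<le> n \<and> W \<subseteq> sphere 0 1 \<and> (\<forall>z\<in>msupp \<mu> - W. Re z \<le> y)"
    using W msupp_sphere by (intro exI[of _ W]) auto
  fix b assume b: "b < y"
  obtain V' where "V' \<subseteq> V" "card V' = Suc n" "finite V'"
    using obtain_subset_with_card_n[of "Suc n" V] V(3) by (metis Suc_leI)
  then show "\<exists>W\<subseteq>msupp \<mu>. finite W \<and> card W = Suc n \<and> (\<forall>w\<in>W. b < Re w)"
    using V(1,4) b by (intro exI[of _ V']) (auto intro: less_le_trans)
qed

lemma nth_top_0: "1 \<in> msupp \<mu> \<Longrightarrow> nth_top 0 1"
  by (rule nth_topI[of "{}" _ _ "{1}"]) (auto intro: Re_le_1)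

text \<open>\<open>C\<close> with the first j pairs is the exceptional set, and \<open>C\<close>
  with the first j + 1 pairs provides the points at or above the value. The two admissible n are the
  two places taken by pair j + 1.\<close>

lemma nth_top_cos:
  assumes C: "C \<subseteq> {1}"
    and S: "Sset \<mu> = C \<union> (\<Union>i\<in>J. {cis (\<phi> i), cis (- \<phi> i)})"
    and J: "J \<subseteq> {1..}" "{1..Suc j} \<subseteq> J"
    and \<phi>: "\<And>i. i \<in> J \<Longrightarrow> 0 < \<phi> i \<and> \<phi> i < Theta \<mu>" "\<And>i k. i \<in> J \<Longrightarrow> k \<in> J \<Longrightarrow> i < k \<Longrightarrow> \<phi> i < \<phi> k"
    and n: "card C + 2 * j \<le> n" "n < card C + 2 * Suc j"
  shows "nth_top n (cos (\<phi> (Suc j)))"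
proof -
  define P where "P k = C \<union> (\<Union>i\<in>{1..k}. {cis (\<phi> i), cis (- \<phi> i)})" for k
  have pi: "0 < \<phi> i \<and> \<phi> i < pi" if "i \<in> J" for i using \<phi>(1)[OF that] Theta_le_pi by simp
  have le: "\<phi> i \<le> \<phi> k" if "i \<in> J" "k \<in> J" "i \<le> k" for i k
    using \<phi>(2)[of i k] that by (cases "i = k") auto
  have card: "card (P k) = card C + 2 * k" if "k \<le> Suc j" for k
  proof -
    have "{1..k} \<subseteq> J" using that J(2) by auto
    moreover then have "inj_on \<phi> {1..k}"
      using \<phi>(2) by (auto simp: inj_on_def) (metis less_irrefl linorder_neqE_nat subsetD atLeastAtMost_iff One_nat_def)
    ultimately show ?thesis unfolding P_def
      by (subst card_conjugate_pairs) (use pi C in auto)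
  qed
  have finC: "finite C" using C finite_subset by blast
  have fin: "finite (P k)" for k using finC by (simp add: P_def)
  have sub: "P k \<subseteq> Sset \<mu>" if "k \<le> Suc j" for k
  proof -
    have "{1..k} \<subseteq> J" using that J(2) by auto
    then show ?thesis unfolding P_def S by blast
  qed
  have Sj: "Suc j \<in> J" using J(2) by auto
  show ?thesis
  proof (rule nth_topI)
    show "P j \<subseteq> msupp \<mu>" "P (Suc j) \<subseteq> msupp \<mu>"
      using sub[of j] sub[of "Suc j"] by (auto simp: Sset_def)
    show "finite (P j)" "finite (P (Suc j))" by (rule fin)+
    show "card (P j) \<le> n" "n < card (P (Suc j))" using card[of j] card[of "Suc j"] n by auto
    fix z
    show "Re z \<le> cos (\<phi> (Suc j))" if z: "z \<in> msupp \<mu> - P j"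
    proof (cases "z \<in> Sset \<mu>")
      case False
      have "cos (Theta \<mu>) \<le> cos (\<phi> (Suc j))"
        using \<phi>(1)[OF Sj] Theta_le_pi by (intro cos_monotone_0_pi_le) auto
      then show ?thesis using Re_le_cos_Theta[of z] False z by simp
    next
      case True
      then obtain i where i: "i \<in> J" "z \<in> {cis (\<phi> i), cis (- \<phi> i)}" "i \<notin> {1..j}"
        using z unfolding S P_def by blast
      then have "Suc j \<le> i" using J(1) by auto
      then have "cos (\<phi> i) \<le> cos (\<phi> (Suc j))"
        using le[OF Sj i(1)] pi[OF i(1)] pi[OF Sj] by (intro cos_monotone_0_pi_le) auto
      then show ?thesis using i(2) by auto
    qed
    show "cos (\<phi> (Suc j)) \<le> Re z" if z: "z \<in> P (Suc j)"
    proof (cases "z \<in> C")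
      case True
      then show ?thesis using C by auto
    next
      case False
      then obtain i where i: "i \<in> {1..Suc j}" "z \<in> {cis (\<phi> i), cis (- \<phi> i)}"
        using z unfolding P_def by blast
      have iJ: "i \<in> J" using i(1) J(2) by blast
      have "cos (\<phi> (Suc j)) \<le> cos (\<phi> i)"
        using le[OF iJ Sj] i(1) pi[OF iJ] pi[OF Sj] by (intro cos_monotone_0_pi_le) auto
      then show ?thesis using i(2) by auto
    qed
  qed
qed

text \<open>The angles increase to some L \<le> Theta, and cis L is an accumulation point of the
  support, hence essential; so L cannot lie below the infimum Theta.\<close>

lemma tendsto_cos_Theta:
  assumes \<phi>: "\<And>j. 0 < \<phi> j \<and> \<phi> j < Theta \<mu>" "strict_mono \<phi>" "\<And>j. cis (\<phi> j) \<in> msupp \<mu>"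
  shows "(\<lambda>j. cos (\<phi> j)) \<longlonglongrightarrow> cos (Theta \<mu>)"
proof -
  have inc: "incseq \<phi>" using \<phi>(2) by (rule strict_mono_mono)
  have "\<forall>j. \<phi> j \<le> Theta \<mu>" using \<phi>(1) less_imp_le by blast
  then obtain L where L: "\<phi> \<longlonglongrightarrow> L" "\<forall>j. \<phi> j \<le> L" by (rule incseq_convergent[OF inc])
  have less: "\<phi> j < L" for j
    using strict_monoD[OF \<phi>(2), of j "Suc j"] L(2) by (meson less_le_trans lessI)
  have LT: "L \<le> Theta \<mu>"
    by (rule LIMSEQ_le_const2[OF L(1)]) (use \<phi>(1) less_imp_le in blast)
  have L0: "0 < L" using less[of 0] \<phi>(1)[of 0] by simp
  have "cis (\<phi> j) \<noteq> cis L" for j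
    using cos_inj_pi[of "\<phi> j" L] less[of j] \<phi>(1)[of j] LT L0 Theta_le_pi
    by (auto simp: complex_eq_iff)
  moreover have "(\<lambda>j. cis (\<phi> j)) \<longlonglongrightarrow> cis L"
    unfolding cis_conv_exp by (intro tendsto_intros L(1))
  ultimately have "cis L islimpt msupp \<mu>"
    unfolding islimpt_sequential using \<phi>(3) by (intro exI[of _ "\<lambda>j. cis (\<phi> j)"]) auto
  then have "cis L \<in> ess_supp \<mu>" by (rule ess_suppI)
  then have "L \<in> ess_angles"
    unfolding ess_angles_def using L0 LT Theta_le_pi by (intro CollectI exI[of _ L]) auto
  then have "L = Theta \<mu>" using Theta_le LT by (intro antisym)
  then show ?thesis using tendsto_cos[OF L(1)] by simp
qed

lemma nth_top_finite:
  assumes C: "C \<subseteq> {1}"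
    and S: "Sset \<mu> = C \<union> (\<Union>i\<in>{1..m}. {cis (\<phi> i), cis (- \<phi> i)})"
    and card: "card (Sset \<mu>) = card C + 2 * m"
    and \<phi>: "\<And>i. i \<in> {1..m} \<Longrightarrow> 0 < \<phi> i \<and> \<phi> i < Theta \<mu>" "\<And>i. i \<in> {1..<m} \<Longrightarrow> \<phi> i < \<phi> (Suc i)"
    and n: "card C + 2 * j \<le> n" "n < card C + 2 * Suc j"
  shows "nth_top n (if Suc j \<le> m then cos (\<phi> (Suc j)) else cos (Theta \<mu>))"
proof (cases "Suc j \<le> m")
  case True
  have "\<phi> i < \<phi> k" if "i \<in> {1..m}" "k \<in> {1..m}" "i < k" for i k
    by (rule less_of_less_Suc_on_interval[of 1 m \<phi>]) (use \<phi>(2) that in auto)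
  then have "nth_top n (cos (\<phi> (Suc j)))"
    by (intro nth_top_cos[OF C S _ _ \<phi>(1) _ n]) (use True in auto)
  then show ?thesis using True by simp
next
  case False
  have "finite C" using C finite_subset by blast
  then have "finite (Sset \<mu>)" unfolding S by simp
  then show ?thesis using nth_top_Theta[of n] card n(1) False by simp
qed

lemma nth_top_infinite:
  assumes C: "C \<subseteq> {1}"
    and S: "Sset \<mu> = C \<union> (\<Union>i\<in>{1..}. {cis (\<phi> i), cis (- \<phi> i)})"
    and \<phi>: "\<And>i. i \<ge> 1 \<Longrightarrow> 0 < \<phi> i \<and> \<phi> i < Theta \<mu> \<and> \<phi> i < \<phi> (Suc i)"
  shows "card C + 2 * j \<le> n \<Longrightarrow> n < card C + 2 * Suc j \<Longrightarrow> nth_top n (cos (\<phi> (Suc j)))"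
    and "(\<lambda>j. cos (\<phi> j)) \<longlonglongrightarrow> cos (Theta \<mu>)"
proof -
  have mono: "\<phi> i < \<phi> k" if "i \<in> {1..}" "i < k" for i k
    by (rule less_of_less_Suc_on_interval[of 1 k \<phi>]) (use \<phi> that in auto)
  then show "nth_top n (cos (\<phi> (Suc j)))" if "card C + 2 * j \<le> n" "n < card C + 2 * Suc j"
    using that \<phi> by (intro nth_top_cos[OF C S]) auto
  have "cis (\<phi> (Suc j)) \<in> Sset \<mu>" for j unfolding S by auto
  then have "(\<lambda>j. cos (\<phi> (Suc j))) \<longlonglongrightarrow> cos (Theta \<mu>)"
    using \<phi> by (intro tendsto_cos_Theta) (auto simp: Sset_def strict_mono_Suc_iff)
  then show "(\<lambda>j. cos (\<phi> j)) \<longlonglongrightarrow> cos (Theta \<mu>)" by (rule LIMSEQ_imp_Suc)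
qed

end

section \<open>Transfer to the given solution and the final limits\<close>

locale circle_schur_flow = circle_measure +
  fixes \<alpha> :: "nat \<Rightarrow> real \<Rightarrow> real"
  assumes init: "verblunsky \<mu> n = complex_of_real (\<alpha> n 0)"
    and schur: "schur_flow \<alpha>"
begin

definition e :: "nat \<Rightarrow> real \<Rightarrow> real" where
  "e n t = (if n = 0 then -1 else \<alpha> (n - 1) t)"

lemma e_Suc [simp]: "e (Suc n) = \<alpha> n"
  by (simp add: e_def fun_eq_iff)

sublocale bounded_schur_flow e
proof
  show "e 0 t = -1" for t by (simp add: e_def)
  show "\<bar>e n t\<bar> \<le> 1" for n t
    using schur by (auto simp: e_def schur_flow_def less_imp_le)
  show "(e n has_real_derivative (1 - (e n t)\<^sup>2) * (e (Suc n) t - e (n - 1) t)) (at t)" for n t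
  proof (cases n)
    case 0
    then show ?thesis by (simp add: e_def[abs_def])
  next
    case (Suc m)
    then show ?thesis using schur by (auto simp: schur_flow_def e_def[of m])
  qed
qed

text \<open>Both sides solve the flow with the same initial values. The left side is complex a
  priori, which is why uniqueness was proved for complex sequences.\<close>

lemma verb_eq:
  assumes "t \<ge> 0"
  shows "verb t n = of_real (\<alpha> n t)"
proof (rule schur_flow_unique[where f = "\<lambda>n t. verb t n" and g = "\<lambda>n t. of_real (\<alpha> n t)", OF _ _ _ _ _ assms])
  fix n t
  show "((\<lambda>t. verb t n) has_vector_derivative (1 - complex_of_real ((cmod (verb t n))\<^sup>2)) *
      (verb t (Suc n) - (if n = 0 then - 1 else verb t (n - 1)))) (at t)"
    using verb_schur_flow[of n t] by (simp add: verb_prev_def)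
  show "norm (verb t n) \<le> 1" using norm_verb_less_1[of t n] by simp
  have a: "\<bar>\<alpha> n t\<bar> < 1" "(\<alpha> n has_real_derivative
        ((1 - (\<alpha> n t)\<^sup>2) * (\<alpha> (Suc n) t - (if n = 0 then -1 else \<alpha> (n - 1) t)))) (at t)"
    using schur by (auto simp: schur_flow_def)
  show "norm (complex_of_real (\<alpha> n t)) \<le> 1" using a(1) by simp
  have "((\<lambda>t. complex_of_real (\<alpha> n t)) has_vector_derivative
     of_real ((1 - (\<alpha> n t)\<^sup>2) * (\<alpha> (Suc n) t - (if n = 0 then -1 else \<alpha> (n - 1) t)))) (at t)"
    using a(2) unfolding has_real_derivative_iff_has_vector_derivative
    by (rule bounded_linear.has_vector_derivative[OF bounded_linear_of_real])
  then show "((\<lambda>t. complex_of_real (\<alpha> n t)) has_vector_derivative (1 - complex_of_real ((cmod (complex_of_real (\<alpha> n t)))\<^sup>2)) *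
      (of_real (\<alpha> (Suc n) t) - (if n = 0 then - 1 else of_real (\<alpha> (n - 1) t)))) (at t)"
    by (cases "n = 0") simp_all
  show "verb 0 n = of_real (\<alpha> n 0)" by (simp add: init flip: verblunsky_eq_verb)
qed

lemma product_tendsto:
  assumes "nth_top n y"
  shows "((\<lambda>t. e n t * e (Suc n) t) \<longlongrightarrow> - y) at_top"
proof -
  obtain l where l: "((\<lambda>t. e n t * e (Suc n) t) \<longlongrightarrow> l) at_top" using product_convergent by blast
  have "\<forall>\<^sub>F t in at_top. e n t * e (Suc n) t = Re (cnj (verb_prev t n) * verb t n)"
    using eventually_ge_at_top[of 0]
    by eventually_elim (simp add: verb_prev_def verb_eq e_def)
  from limit_eq_nth_top[OF assms Lim_transform_eventually[OF l this]] l show ?thesis by simp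
qed

text \<open>The alternation starts from e 0 = -1, with sign s = -1.\<close>

lemma tendsto_without_1:
  assumes "\<And>j. nth_top (2 * j) (X j)" "\<And>j. nth_top (2 * j + 1) (X j)"
  shows "(\<alpha> (2 * n + 1) \<longlongrightarrow> -1) at_top" "(\<alpha> (2 * n) \<longlongrightarrow> X n) at_top"
proof -
  have s: "(e 0 \<longlongrightarrow> -1) at_top" by (simp add: e_def[abs_def])
  have p: "((\<lambda>t. e (0 + 2 * j) t * e (Suc (0 + 2 * j)) t) \<longlongrightarrow> - X j) at_top"
    "((\<lambda>t. e (Suc (0 + 2 * j)) t * e (Suc (Suc (0 + 2 * j))) t) \<longlongrightarrow> - X j) at_top" for j
    using product_tendsto[OF assms(1)[of j]] product_tendsto[OF assms(2)[of j]] by simp_all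
  show "(\<alpha> (2 * n + 1) \<longlongrightarrow> -1) at_top"
    using tendsto_alternating(1)[OF s _ p, of "Suc n"] by simp
  show "(\<alpha> (2 * n) \<longlongrightarrow> X n) at_top"
    using tendsto_alternating(2)[OF s _ p, of n] by simp
qed

text \<open>The point 1 is the top value, so e 0 * e 1 tends to -1 and e 1 to 1. The alternation
  starts there, with sign s = 1.\<close>

lemma tendsto_with_1:
  assumes "1 \<in> msupp \<mu>" "\<And>j. nth_top (1 + 2 * j) (X j)" "\<And>j. nth_top (1 + 2 * j + 1) (X j)"
  shows "(\<alpha> (2 * n) \<longlongrightarrow> 1) at_top" "(\<alpha> (2 * n + 1) \<longlongrightarrow> - X n) at_top"
proof -
  have "(e 0 \<longlongrightarrow> -1) at_top" by (simp add: e_def[abs_def])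
  from tendsto_second_factor[OF this _ product_tendsto[OF nth_top_0[OF assms(1)]]]
  have s: "(e 1 \<longlongrightarrow> 1) at_top" by simp
  have p: "((\<lambda>t. e (1 + 2 * j) t * e (Suc (1 + 2 * j)) t) \<longlongrightarrow> - X j) at_top"
    "((\<lambda>t. e (Suc (1 + 2 * j)) t * e (Suc (Suc (1 + 2 * j))) t) \<longlongrightarrow> - X j) at_top" for j
    using product_tendsto[OF assms(2)[of j]] product_tendsto[OF assms(3)[of j]] by simp_all
  show "(\<alpha> (2 * n) \<longlongrightarrow> 1) at_top"
    using tendsto_alternating(1)[OF s _ p, of n] by simp
  show "(\<alpha> (2 * n + 1) \<longlongrightarrow> - X n) at_top"
    using tendsto_alternating(2)[OF s _ p, of n] by simp
qed

end

theorem theorem4p5: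
  fixes \<mu> :: "complex measure" and \<alpha> :: "nat \<Rightarrow> real \<Rightarrow> real"
  assumes "prob_space \<mu>"
    and "sets \<mu> = sets borel"
    and "emeasure \<mu> (sphere 0 1) = 1"
    and "infinite (msupp \<mu>)"
    and "\<forall>n. verblunsky \<mu> n = complex_of_real (\<alpha> n 0)"
    and "schur_flow \<alpha>"
  shows
   "(1 \<in> ess_supp \<mu> \<longrightarrow> (\<forall>n. (\<alpha> n \<longlongrightarrow> (-1) ^ n) at_top))
  \<and> (\<forall>m \<theta>. Theta \<mu> > 0 \<and> 1 \<notin> msupp \<mu> \<and> finite (Sset \<mu>) \<and> card (Sset \<mu>) = 2 * m
        \<and> (\<forall>j\<in>{1..m}. 0 < \<theta> j \<and> \<theta> j < Theta \<mu>) \<and> (\<forall>j\<in>{1..<m}. \<theta> j < \<theta> (Suc j))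
        \<and> Sset \<mu> = (\<Union>j\<in>{1..m}. {cis (\<theta> j), cis (- \<theta> j)}) \<longrightarrow>
      (let N = m + 1; x = (\<lambda>j. if j \<le> m then cos (\<theta> j) else cos (Theta \<mu>)) in
        (\<forall>n. (\<alpha> (2 * n + 1) \<longlongrightarrow> -1) at_top)
        \<and> (\<forall>n<N. (\<alpha> (2 * n) \<longlongrightarrow> x (n + 1)) at_top)
        \<and> (\<forall>n\<ge>N - 1. (\<alpha> (2 * n) \<longlongrightarrow> x N) at_top)))
  \<and> (\<forall>\<theta>. Theta \<mu> > 0 \<and> 1 \<notin> msupp \<mu> \<and> infinite (Sset \<mu>)
        \<and> (\<forall>j\<ge>1. 0 < \<theta> j \<and> \<theta> j < Theta \<mu> \<and> \<theta> j < \<theta> (Suc j))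
        \<and> Sset \<mu> = (\<Union>j\<in>{1..}. {cis (\<theta> j), cis (- \<theta> j)}) \<longrightarrow>
      (let x = (\<lambda>j. cos (\<theta> j)) in
        (\<forall>n. (\<alpha> (2 * n + 1) \<longlongrightarrow> -1) at_top \<and> (\<alpha> (2 * n) \<longlongrightarrow> x (n + 1)) at_top)
        \<and> x \<longlonglongrightarrow> cos (Theta \<mu>)))
  \<and> (\<forall>m \<theta>. Theta \<mu> > 0 \<and> 1 \<in> msupp \<mu> \<and> finite (Sset \<mu>) \<and> card (Sset \<mu>) = 2 * m + 1
        \<and> (\<forall>j\<in>{2..m+1}. 0 < \<theta> j \<and> \<theta> j < Theta \<mu>) \<and> (\<forall>j\<in>{2..<m+1}. \<theta> j < \<theta> (Suc j))
        \<and> Sset \<mu> = insert 1 (\<Union>j\<in>{2..m+1}. {cis (\<theta> j), cis (- \<theta> j)}) \<longrightarrow>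
      (let N = m + 1; x = (\<lambda>j. if j \<le> m then cos (\<theta> (j + 1)) else cos (Theta \<mu>)) in
        (\<forall>n. (\<alpha> (2 * n) \<longlongrightarrow> 1) at_top)
        \<and> (\<forall>n. 1 \<le> n \<and> n < N \<longrightarrow> (\<alpha> (2 * n - 1) \<longlongrightarrow> - x n) at_top)
        \<and> (\<forall>n\<ge>N. (\<alpha> (2 * n - 1) \<longlongrightarrow> - x N) at_top)))
  \<and> (\<forall>\<theta>. Theta \<mu> > 0 \<and> 1 \<in> msupp \<mu> \<and> infinite (Sset \<mu>)
        \<and> (\<forall>j\<ge>2. 0 < \<theta> j \<and> \<theta> j < Theta \<mu> \<and> \<theta> j < \<theta> (Suc j))
        \<and> Sset \<mu> = insert 1 (\<Union>j\<in>{2..}. {cis (\<theta> j), cis (- \<theta> j)}) \<longrightarrow>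
      (let x = (\<lambda>j. cos (\<theta> (j + 1))) in
        (\<forall>n. (\<alpha> (2 * n) \<longlongrightarrow> 1) at_top)
        \<and> (\<forall>n\<ge>1. (\<alpha> (2 * n - 1) \<longlongrightarrow> - x n) at_top)
        \<and> x \<longlonglongrightarrow> cos (Theta \<mu>)))"
  proof -
  interpret circle_schur_flow \<mu> \<alpha>
    by (intro circle_schur_flow.intro circle_measure.intro circle_measure_axioms.intro
        circle_schur_flow_axioms.intro) (use assms in auto)
  show ?thesis
  proof (intro conjI, goal_cases)
    case 1
    show ?case
    proof (intro impI allI)
      fix n assume "1 \<in> ess_supp \<mu>"
      \<comment> \<open>All values in the list equal 1, so \<open>X\<close> is constant.\<close>
      note lim = tendsto_without_1[OF nth_top_1[OF this] nth_top_1[OF this]]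
      show "(\<alpha> n \<longlongrightarrow> (-1) ^ n) at_top"
        by (cases "even n") (use lim in \<open>auto elim!: evenE oddE\<close>)
    qed
  next
    case 2
    show ?case
    proof (intro allI impI, goal_cases)
      case (1 m \<theta>)
      have nt: "nth_top (2 * j) (if j + 1 \<le> m then cos (\<theta> (j + 1)) else cos (Theta \<mu>))"
        "nth_top (2 * j + 1) (if j + 1 \<le> m then cos (\<theta> (j + 1)) else cos (Theta \<mu>))" for j
        unfolding Suc_eq_plus1[symmetric] by (rule nth_top_finite[of "{}"]; use 1 in auto)+
      note lim = tendsto_without_1[OF nt]
      show ?case unfolding Let_def
      proof (intro conjI allI impI)
        show "(\<alpha> (2 * n) \<longlongrightarrow> (if m + 1 \<le> m then cos (\<theta> (m + 1)) else cos (Theta \<mu>))) at_top"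
          if "m + 1 - 1 \<le> n" for n
          using lim(2)[of n] that by simp
      qed (rule lim)+
    qed
  next
    case 3
    show ?case
    proof (intro allI impI, goal_cases)
      case (1 \<theta>)
      have S: "Sset \<mu> = {} \<union> (\<Union>i\<in>{1..}. {cis (\<theta> i), cis (- \<theta> i)})" using 1 by simp
      have "0 < \<theta> i \<and> \<theta> i < Theta \<mu> \<and> \<theta> i < \<theta> (Suc i)" if "i \<ge> 1" for i using 1 that by blast
      note inf = nth_top_infinite[OF empty_subsetI S this]
      have nt: "nth_top (2 * j) (cos (\<theta> (Suc j)))" "nth_top (2 * j + 1) (cos (\<theta> (Suc j)))" for j
        by (rule inf(1); simp)+
      show ?case using tendsto_without_1[OF nt] inf(2) by simp
    qed
  next
    case 4
    show ?case
    proof (intro allI impI, goal_cases)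
      case (1 m \<theta>)
      \<comment> \<open>The angles are numbered from 2 here; the shift by \<open>Suc\<close> brings
        the pairs back to the range from 1.\<close>
      have img: "{2..m + 1} = Suc ` {1..m}" by (simp add: numeral_2_eq_2)
      have "Sset \<mu> = insert 1 (\<Union>j\<in>{2..m + 1}. {cis (\<theta> j), cis (- \<theta> j)})" using 1 by blast
      then have S: "Sset \<mu> = {1} \<union> (\<Union>i\<in>{1..m}. {cis (\<theta> (Suc i)), cis (- \<theta> (Suc i))})"
        unfolding img image_image insert_is_Un[of 1 "Union _"] .
      have nt: "nth_top (1 + 2 * j) (if Suc j \<le> m then cos (\<theta> (Suc (Suc j))) else cos (Theta \<mu>))"
        "nth_top (1 + 2 * j + 1) (if Suc j \<le> m then cos (\<theta> (Suc (Suc j))) else cos (Theta \<mu>))" for j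
        by (rule nth_top_finite[OF subset_refl S]; use 1 in auto)+
      have "1 \<in> msupp \<mu>" using 1 by blast
      note lim = tendsto_with_1[OF this nt]
      \<comment> \<open>For n \<ge> 1 the index 2 n - 1 is 2 (n - 1) + 1, so the general limit is
        taken at n - 1.\<close>
      have odd: "(\<alpha> (2 * n - 1) \<longlongrightarrow> - (if n \<le> m then cos (\<theta> (n + 1)) else cos (Theta \<mu>))) at_top"
        if "1 \<le> n" for n
        using lim(2)[of "n - 1"] that by (cases n) auto
      show ?case unfolding Let_def
      proof (intro conjI allI impI)
        show "(\<alpha> (2 * n - 1) \<longlongrightarrow> - (if m + 1 \<le> m then cos (\<theta> (m + 1 + 1)) else cos (Theta \<mu>))) at_top"
          if "m + 1 \<le> n" for n
          using odd[of n] that by simp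
        show "(\<alpha> (2 * n - 1) \<longlongrightarrow> - (if n \<le> m then cos (\<theta> (n + 1)) else cos (Theta \<mu>))) at_top"
          if "1 \<le> n \<and> n < m + 1" for n
          using that by (intro odd) simp
      qed (rule lim)
    qed
  next
    case 5
    show ?case
    proof (intro allI impI, goal_cases)
      case (1 \<theta>)
      have img: "{2..} = Suc ` {1..}"
      proof (intro equalityI subsetI)
        fix j :: nat assume "j \<in> {2..}"
        then show "j \<in> Suc ` {1..}" by (intro image_eqI[of _ _ "j - 1"]) auto
      qed auto
      have "Sset \<mu> = insert 1 (\<Union>j\<in>{2..}. {cis (\<theta> j), cis (- \<theta> j)})" using 1 by blast
      then have S: "Sset \<mu> = {1} \<union> (\<Union>i\<in>{1..}. {cis (\<theta> (Suc i)), cis (- \<theta> (Suc i))})"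
        unfolding img image_image insert_is_Un[of 1 "Union _"] .
      have "0 < \<theta> (Suc i) \<and> \<theta> (Suc i) < Theta \<mu> \<and> \<theta> (Suc i) < \<theta> (Suc (Suc i))" if "i \<ge> 1" for i
        using 1 that by simp
      note inf = nth_top_infinite[OF subset_refl S this]
      have nt: "nth_top (1 + 2 * j) (cos (\<theta> (Suc (Suc j))))"
        "nth_top (1 + 2 * j + 1) (cos (\<theta> (Suc (Suc j))))" for j
        by (rule inf(1); simp)+
      have "1 \<in> msupp \<mu>" using 1 by blast
      note lim = tendsto_with_1[OF this nt]
      have "(\<alpha> (2 * n - 1) \<longlongrightarrow> - cos (\<theta> (n + 1))) at_top" if "n \<ge> 1" for n
        using lim(2)[of "n - 1"] that by (cases n) auto
      then show ?case using lim(1) inf(2) by simp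
    qed
  qed
qed

end
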